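(* Let $\kappa$ be a singular cardinal with $\operatorname{cf}(\kappa)=\lambda$. Then the forcings $\mathbb{M}_\kappa$, $\mathbb{M}^{\mathrm{club}}_\kappa$ and $\mathbb{M}^{\mathrm{stat}}_\kappa$ are not $\omega$-distributive (each adds a function from $\omega$ to the ordinals that is not in the ground model).
   Context: Fix a strictly increasing sequence $\langle\kappa_\alpha:\alpha<\lambda\rangle$ of regular infinite cardinals with supremum $\kappa$. Let $N=\bigcup_{\alpha<\lambda}\prod_{\beta<\alpha}\kappa_\beta$ (functions $t$ with $\mathrm{dom}(t)$ an ordinal $<\lambda$ and $t(\beta)<\kappa_\beta$), ordered by end-extension $\sqsubseteq$. A tree is a nonempty $T\subseteq N$ closed under initial segments; $\mathrm{Succ}_T(t)$ and $\mathrm{OSucc}_T(t)=\{\beta:t^\frown\langle\beta\rangle\in T\}$ denote the immediate successors and ordinal successor set. $T$ is $(<\lambda)$-closed if every node has a proper extension in $T$ and whenever $\delta<\lambda$ is a limit and $f$ has domain $\delta$ with $f\restriction\beta\in T$ for all $\beta<\delta$, then $f\in T$. $T$ is ever-branching if for all $s\in T$ and $\alpha<\lambda$ there is $t\in T$ with $s\sqsubseteq t$ and $|\mathrm{Succ}_T(t)|\ge\kappa_\alpha$. $T$ is perfect if it is $(<\lambda)$-closed and ever-branching. $\mathbb{M}_\kappa$: perfect trees; $\mathbb{M}^{\mathrm{stat}}_\kappa$ (resp. $\mathbb{M}^{\mathrm{club}}_\kappa$): perfect trees $p$ such that every node has an extension $t\in p$ with $\mathrm{OSucc}_p(t)$ a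 stationary subset of $\{\beta<\kappa_{\mathrm{dom}(t)}:\operatorname{cf}\beta=\omega\}$ (resp. containing a club subset of $\kappa_{\mathrm{dom}(t)}$). All are ordered by inclusion. *)

theory Defs
  imports Main "HOL-Library.Equipollence"
begin

text \<open>
  Ordinals are elements of an arbitrary type \<open>'o\<close> of class \<open>wellorder\<close>: the element \<open>x\<close> stands
  for the order type of \<open>{..<x}\<close>, that is, for the von Neumann ordinal \<open>x = {y. y < x}\<close>.
\<close>

section \<open>Ordinals and cardinals\<close>

definition limit_ord :: "'o::wellorder \<Rightarrow> bool" where
  "limit_ord \<delta> \<longleftrightarrow> (\<exists>\<beta>. \<beta> < \<delta>) \<and> (\<forall>\<beta><\<delta>. \<exists>\<gamma>. \<beta> < \<gamma> \<and> \<gamma> < \<delta>)"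

definition infinite_cardinal :: "'o::wellorder \<Rightarrow> bool" where
  "infinite_cardinal \<mu> \<longleftrightarrow> infinite {..<\<mu>} \<and> (\<forall>\<nu><\<mu>. {..<\<nu>} \<prec> {..<\<mu>})"

definition cofinality :: "'o::wellorder \<Rightarrow> 'o" where
  "cofinality x = (LEAST \<mu>. \<exists>f :: 'o \<Rightarrow> 'o.
     (\<forall>\<xi><\<mu>. f \<xi> < x) \<and> (\<forall>y<x. \<exists>\<xi><\<mu>. y \<le> f \<xi>))"

definition regular_cardinal :: "'o::wellorder \<Rightarrow> bool" where
  "regular_cardinal \<mu> \<longleftrightarrow> infinite_cardinal \<mu> \<and> cofinality \<mu> = \<mu>"

definition singular_cardinal :: "'o::wellorder \<Rightarrow> bool" where
  "singular_cardinal \<mu> \<longleftrightarrow> infinite_cardinal \<mu> \<and> cofinality \<mu> < \<mu>"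

text \<open>Only meaningful if \<open>'o\<close> has an element with infinitely many predecessors.\<close>

definition omega_ord :: "'o::wellorder" where
  "omega_ord = (LEAST x. infinite {..<x})"

definition club_in :: "'o::wellorder \<Rightarrow> 'o set \<Rightarrow> bool" where
  "club_in \<mu> C \<longleftrightarrow> C \<subseteq> {..<\<mu>} \<and> (\<forall>\<beta><\<mu>. \<exists>\<gamma>\<in>C. \<beta> \<le> \<gamma>) \<and>
     (\<forall>\<delta><\<mu>. limit_ord \<delta> \<and> (\<forall>\<beta><\<delta>. \<exists>\<gamma>\<in>C. \<beta> < \<gamma> \<and> \<gamma> < \<delta>) \<longrightarrow> \<delta> \<in> C)"

definition stationary_in :: "'o::wellorder \<Rightarrow> 'o set \<Rightarrow> bool" where
  "stationary_in \<mu> S \<longleftrightarrow> S \<subseteq> {..<\<mu>} \<and> (\<forall>C. club_in \<mu> C \<longrightarrow> S \<inter> C \<noteq> {})"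

section \<open>Trees\<close>

text \<open>
  A node is a partial function whose domain is an ordinal below \<open>lam\<close>. Since domains are initial
  segments, \<open>map_le\<close> (written \<open>\<subseteq>\<^sub>m\<close>) between nodes is end-extension.
\<close>

definition nodes :: "'o::wellorder \<Rightarrow> ('o \<Rightarrow> 'o) \<Rightarrow> ('o \<rightharpoonup> 'o) set" where
  "nodes lam \<kappa>s = {t. \<exists>\<alpha><lam. dom t = {..<\<alpha>} \<and> (\<forall>\<beta><\<alpha>. the (t \<beta>) < \<kappa>s \<beta>)}"

text \<open>The ordinal that is the domain of a node.\<close>

definition ht :: "('o::wellorder \<rightharpoonup> 'o) \<Rightarrow> 'o" where
  "ht t = (THE \<alpha>. dom t = {..<\<alpha>})"

definition snoc :: "('o::wellorder \<rightharpoonup> 'o) \<Rightarrow> 'o \<Rightarrow> ('o \<rightharpoonup> 'o)" where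
  "snoc t \<beta> = t(ht t \<mapsto> \<beta>)"

definition is_tree :: "'o::wellorder \<Rightarrow> ('o \<Rightarrow> 'o) \<Rightarrow> ('o \<rightharpoonup> 'o) set \<Rightarrow> bool" where
  "is_tree lam \<kappa>s T \<longleftrightarrow> T \<noteq> {} \<and> T \<subseteq> nodes lam \<kappa>s \<and>
     (\<forall>t\<in>T. \<forall>s\<in>nodes lam \<kappa>s. s \<subseteq>\<^sub>m t \<longrightarrow> s \<in> T)"

definition OSucc :: "('o::wellorder \<rightharpoonup> 'o) set \<Rightarrow> ('o \<rightharpoonup> 'o) \<Rightarrow> 'o set" where
  "OSucc T t = {\<beta>. snoc t \<beta> \<in> T}"

definition Succ :: "('o::wellorder \<rightharpoonup> 'o) set \<Rightarrow> ('o \<rightharpoonup> 'o) \<Rightarrow> ('o \<rightharpoonup> 'o) set" where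
  "Succ T t = snoc t ` OSucc T t"

definition lt_closed :: "'o::wellorder \<Rightarrow> ('o \<rightharpoonup> 'o) set \<Rightarrow> bool" where
  "lt_closed lam T \<longleftrightarrow> (\<forall>t\<in>T. \<exists>s\<in>T. t \<subseteq>\<^sub>m s \<and> s \<noteq> t) \<and>
     (\<forall>\<delta><lam. limit_ord \<delta> \<longrightarrow>
        (\<forall>f. dom f = {..<\<delta>} \<and> (\<forall>\<beta><\<delta>. f |` {..<\<beta>} \<in> T) \<longrightarrow> f \<in> T))"

definition ever_branching :: "'o::wellorder \<Rightarrow> ('o \<Rightarrow> 'o) \<Rightarrow> ('o \<rightharpoonup> 'o) set \<Rightarrow> bool" where
  "ever_branching lam \<kappa>s T \<longleftrightarrow>
     (\<forall>s\<in>T. \<forall>\<alpha><lam. \<exists>t\<in>T. s \<subseteq>\<^sub>m t \<and> {..<\<kappa>s \<alpha>} \<lesssim> Succ T t)"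

definition perfect_tree :: "'o::wellorder \<Rightarrow> ('o \<Rightarrow> 'o) \<Rightarrow> ('o \<rightharpoonup> 'o) set \<Rightarrow> bool" where
  "perfect_tree lam \<kappa>s T \<longleftrightarrow> is_tree lam \<kappa>s T \<and> lt_closed lam T \<and> ever_branching lam \<kappa>s T"

definition M_forcing :: "'o::wellorder \<Rightarrow> ('o \<Rightarrow> 'o) \<Rightarrow> ('o \<rightharpoonup> 'o) set set" where
  "M_forcing lam \<kappa>s = {p. perfect_tree lam \<kappa>s p}"

definition M_stat :: "'o::wellorder \<Rightarrow> ('o \<Rightarrow> 'o) \<Rightarrow> ('o \<rightharpoonup> 'o) set set" where
  "M_stat lam \<kappa>s = {p. perfect_tree lam \<kappa>s p \<and>
     (\<forall>s\<in>p. \<exists>t\<in>p. s \<subseteq>\<^sub>m t \<and>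
        OSucc p t \<subseteq> {\<beta>. \<beta> < \<kappa>s (ht t) \<and> cofinality \<beta> = omega_ord} \<and>
        stationary_in (\<kappa>s (ht t)) (OSucc p t))}"

definition M_club :: "'o::wellorder \<Rightarrow> ('o \<Rightarrow> 'o) \<Rightarrow> ('o \<rightharpoonup> 'o) set set" where
  "M_club lam \<kappa>s = {p. perfect_tree lam \<kappa>s p \<and>
     (\<forall>s\<in>p. \<exists>t\<in>p. s \<subseteq>\<^sub>m t \<and> (\<exists>C. club_in (\<kappa>s (ht t)) C \<and> C \<subseteq> OSucc p t))}"

section \<open>Forcing\<close>

text \<open>
  A forcing notion is a set \<open>P\<close> of elements of an ordered type, with the induced order; smaller
  conditions are stronger. For sets of trees this order is inclusion.
\<close>

definition open_dense :: "'p::order set \<Rightarrow> 'p set \<Rightarrow> bool" where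
  "open_dense P D \<longleftrightarrow> D \<subseteq> P \<and> (\<forall>d\<in>D. \<forall>q\<in>P. q \<le> d \<longrightarrow> q \<in> D) \<and> (\<forall>p\<in>P. \<exists>d\<in>D. d \<le> p)"

definition omega_distributive :: "'p::order set \<Rightarrow> bool" where
  "omega_distributive P \<longleftrightarrow>
     (\<forall>D :: nat \<Rightarrow> 'p set. (\<forall>n. open_dense P (D n)) \<longrightarrow> open_dense P (\<Inter>n. D n))"

text \<open>
  \<open>\<tau> :: nat \<Rightarrow> 'v \<Rightarrow> 'p set\<close> represents the name \<open>{((n, a)\<^sup>\<or>, s) | s \<in> \<tau> n a}\<close>, where \<open>x\<^sup>\<or>\<close> is the
  canonical name of the ground model object \<open>x\<close>. The following is the usual forcing relation
  \<open>p \<tturnstile> (n, a)\<^sup>\<or> \<in> \<tau>\<close>: the conditions below some \<open>s \<in> \<tau> n a\<close> are dense below \<open>p\<close>.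
\<close>

definition forces_val ::
    "'p::order set \<Rightarrow> (nat \<Rightarrow> 'v \<Rightarrow> 'p set) \<Rightarrow> 'p \<Rightarrow> nat \<Rightarrow> 'v \<Rightarrow> bool" where
  "forces_val P \<tau> p n a \<longleftrightarrow> (\<forall>q\<in>P. q \<le> p \<longrightarrow> (\<exists>r\<in>P. r \<le> q \<and> (\<exists>s\<in>\<tau> n a. r \<le> s)))"

text \<open>Every condition forces \<open>\<tau>\<close> to be a function from \<open>\<omega>\<close> to \<open>A\<close>.\<close>

definition omega_function_name ::
    "'p::order set \<Rightarrow> 'v set \<Rightarrow> (nat \<Rightarrow> 'v \<Rightarrow> 'p set) \<Rightarrow> bool" where
  "omega_function_name P A \<tau> \<longleftrightarrow>
     (\<forall>n a. \<tau> n a \<subseteq> P) \<and> (\<forall>n a. \<tau> n a \<noteq> {} \<longrightarrow> a \<in> A) \<and>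
     (\<forall>n. \<forall>p\<in>P. \<exists>q\<in>P. q \<le> p \<and> (\<exists>a\<in>A. forces_val P \<tau> q n a)) \<and>
     (\<forall>p\<in>P. \<forall>n a b. forces_val P \<tau> p n a \<and> forces_val P \<tau> p n b \<longrightarrow> a = b)"

text \<open>
  Every condition forces that some function from \<open>\<omega>\<close> to the ordinals is not in the ground model:
  no condition forces \<open>\<tau>\<close> to equal a ground model function \<open>g\<close>. The ordinal values are the elements
  of the field of a well-order \<open>W\<close>, which may live on the type of conditions because a name for a
  function on \<open>\<omega>\<close> needs at most \<open>\<aleph>\<^sub>0 \<cdot> |P|\<close> many values, so they can be enumerated in the ground model.
\<close>

definition adds_new_omega_function :: "'p::order set \<Rightarrow> bool" where
  "adds_new_omega_function P \<longleftrightarrow>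
     (\<exists>(W :: 'p rel) (\<tau> :: nat \<Rightarrow> 'p \<Rightarrow> 'p set).
        Well_order W \<and> omega_function_name P (Field W) \<tau> \<and>
        \<not> (\<exists>p\<in>P. \<exists>g :: nat \<Rightarrow> 'p. \<forall>n. forces_val P \<tau> p n (g n)))"

end

theory Submission
  imports Defs
begin

text \<open>
  Say that a condition \<open>q \<subseteq> p\<close> skips splitting nodes of \<open>p\<close> if below every splitting node \<open>t\<close> of
  \<open>q\<close> there is a splitting node of \<open>p\<close> lying strictly above all splitting nodes of \<open>q\<close> below \<open>t\<close>.
  Since limits of splitting nodes need not split, every condition \<open>p\<close> has such a \<open>q\<close> below it. If
  \<open>r\<close> were below all members of a sequence in which each \<open>a (n + 1)\<close> skips splitting nodes of
  \<open>a n\<close>, then the nodes skipped below a splitting node of \<open>r\<close> would have strictly decreasing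
  heights. Hence maximal antichains \<open>A n\<close>, each consisting of conditions that skip splitting nodes
  of members of the previous one, witness the failure of distributivity, and the sequence of the
  elements of \<open>A n\<close> met by the generic filter is new. The last point uses that the forcings are
  separative.
\<close>

section \<open>Maximal antichains and new sequences\<close>

definition maximal_antichain :: "'p::order set \<Rightarrow> 'p set \<Rightarrow> bool" where
  "maximal_antichain P A \<longleftrightarrow> A \<subseteq> P \<and>
     (\<forall>a\<in>A. \<forall>b\<in>A. \<forall>r\<in>P. r \<le> a \<longrightarrow> r \<le> b \<longrightarrow> a = b) \<and>
     (\<forall>p\<in>P. \<exists>a\<in>A. \<exists>r\<in>P. r \<le> p \<and> r \<le> a)"

text \<open>Zorn's lemma yields an antichain that is maximal among those contained in
  \<open>E\<close>. If some \<open>p\<close> in \<open>P\<close> were incompatible with all its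
  members, so would be any element of \<open>E\<close> below \<open>p\<close>, and that element
  could be added.\<close>

lemma maximal_antichain_exists:
  fixes P E :: "'p::order set"
  assumes dense: "\<And>p. p \<in> P \<Longrightarrow> \<exists>q\<in>E. q \<le> p" and EP: "E \<subseteq> P"
  shows "\<exists>A\<subseteq>E. maximal_antichain P A"
proof -
  define F where "F = {A. A \<subseteq> E \<and> (\<forall>a\<in>A. \<forall>b\<in>A. \<forall>r\<in>P. r \<le> a \<longrightarrow> r \<le> b \<longrightarrow> a = b)}"
  have "\<exists>A\<in>F. \<forall>X\<in>F. A \<subseteq> X \<longrightarrow> X = A"
  proof (rule subset_Zorn')
    fix C assume C: "subset.chain F C"
    show "\<Union>C \<in> F"
    proof -
      have "a = b" if "X \<in> C" "Y \<in> C" "a \<in> X" "b \<in> Y" "r \<in> P" "r \<le> a" "r \<le> b" for a b r X Y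
      proof -
        have "X \<subseteq> Y \<or> Y \<subseteq> X" using C that by (auto simp: subset.chain_def)
        moreover have "X \<in> F" "Y \<in> F" using C that by (auto simp: subset.chain_def)
        ultimately show ?thesis using that unfolding F_def by blast
      qed
      then have "\<forall>a\<in>\<Union>C. \<forall>b\<in>\<Union>C. \<forall>r\<in>P. r \<le> a \<longrightarrow> r \<le> b \<longrightarrow> a = b" by fast
      moreover have "\<Union>C \<subseteq> E" using C unfolding F_def subset.chain_def by blast
      ultimately show ?thesis unfolding F_def by simp
    qed
  qed
  then obtain A where A: "A \<in> F" and max: "\<And>X. X \<in> F \<Longrightarrow> A \<subseteq> X \<Longrightarrow> X = A" by blast
  have "\<exists>a\<in>A. \<exists>r\<in>P. r \<le> p \<and> r \<le> a" if p: "p \<in> P" for p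
  proof (rule ccontr)
    assume no: "\<not> (\<exists>a\<in>A. \<exists>r\<in>P. r \<le> p \<and> r \<le> a)"
    obtain q where q: "q \<in> E" "q \<le> p" using dense[OF p] by blast
    have "insert q A \<in> F"
    proof -
      have "\<not> (r \<le> q \<and> r \<le> a)" if "r \<in> P" "a \<in> A" for r a
        using no that q(2) order_trans by blast
      then have "\<forall>a\<in>insert q A. \<forall>b\<in>insert q A. \<forall>r\<in>P. r \<le> a \<longrightarrow> r \<le> b \<longrightarrow> a = b"
        using A unfolding F_def by auto
      moreover have "insert q A \<subseteq> E" using A q(1) unfolding F_def by simp
      ultimately show ?thesis unfolding F_def by (intro CollectI conjI)
    qed
    then have "q \<in> A" using max by blast
    then show False using no q EP by blast
  qed
  then have "maximal_antichain P A"
    using A EP unfolding F_def maximal_antichain_def by (intro conjI) auto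
  moreover have "A \<subseteq> E" using A unfolding F_def by simp
  ultimately show ?thesis by blast
qed

text \<open>An abstract criterion, later applied with \<open>skips\<close> as \<open>R\<close>. By
  \<open>mono\<close>, the relation passes from a condition to the antichain member above it, so
  every maximal antichain has a refinement along \<open>R\<close>; \<open>no_chain\<close> then
  excludes a common lower bound of one member from each antichain.\<close>

lemma not_distributive_and_adds_new_omega_function:
  fixes P :: "'p::order set" and R :: "'p \<Rightarrow> 'p \<Rightarrow> bool"
  assumes ne: "P \<noteq> {}"
    and dense: "\<And>p. p \<in> P \<Longrightarrow> \<exists>q\<in>P. q \<le> p \<and> R q p"
    and mono: "\<And>p p' q. p \<in> P \<Longrightarrow> p' \<in> P \<Longrightarrow> q \<in> P \<Longrightarrow> R q p \<Longrightarrow> p \<le> p' \<Longrightarrow> R q p'"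
    and no_chain: "\<And>r a. r \<in> P \<Longrightarrow> (\<And>n::nat. a n \<in> P \<and> r \<le> a n \<and> R (a (Suc n)) (a n)) \<Longrightarrow> False"
    and separative: "\<And>p a. p \<in> P \<Longrightarrow> a \<in> P \<Longrightarrow>
      (\<And>q. q \<in> P \<Longrightarrow> q \<le> p \<Longrightarrow> \<exists>r\<in>P. r \<le> q \<and> r \<le> a) \<Longrightarrow> p \<le> a"
  shows "\<not> omega_distributive P \<and> adds_new_omega_function P"
proof -
  have MA_sub: "a \<in> P" if "maximal_antichain P A" "a \<in> A" for A a
    using that unfolding maximal_antichain_def by (meson subsetD)
  have MA_uniq: "a = b" if "maximal_antichain P A" "a \<in> A" "b \<in> A" "r \<in> P" "r \<le> a" "r \<le> b" for A a b r
    using that unfolding maximal_antichain_def by meson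
  have MA_compat: "\<exists>a\<in>A. \<exists>r\<in>P. r \<le> p \<and> r \<le> a" if "maximal_antichain P A" "p \<in> P" for A p
    using that unfolding maximal_antichain_def by simp
  have step: "\<exists>B. maximal_antichain P B \<and> (\<forall>b\<in>B. \<exists>a\<in>A. b \<le> a \<and> R b a)" if A: "maximal_antichain P A" for A
  proof -
    \<comment> \<open>A maximal antichain inside this dense set refines \<open>A\<close> along
      \<open>R\<close>.\<close>
    define E where "E = {q\<in>P. \<exists>a\<in>A. q \<le> a \<and> R q a}"
    have "\<exists>q\<in>E. q \<le> p" if "p \<in> P" for p
    proof -
      obtain a r where ar: "a \<in> A" "r \<in> P" "r \<le> p" "r \<le> a" using MA_compat[OF A \<open>p \<in> P\<close>] by blast
      obtain q where q: "q \<in> P" "q \<le> r" "R q r" using dense[OF ar(2)] by blast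
      have "R q a" using mono[OF ar(2) MA_sub[OF A ar(1)] q(1,3) ar(4)] .
      moreover have "q \<le> a" using q(2) ar(4) by (rule order_trans)
      ultimately have "q \<in> E" unfolding E_def using q(1) ar(1) by blast
      moreover have "q \<le> p" using q(2) ar(3) by (rule order_trans)
      ultimately show ?thesis by blast
    qed
    moreover have EP: "E \<subseteq> P" unfolding E_def by blast
    ultimately obtain B where B: "B \<subseteq> E" "maximal_antichain P B"
      using maximal_antichain_exists[of P E] by blast
    have "\<forall>b\<in>B. \<exists>a\<in>A. b \<le> a \<and> R b a" using B(1) unfolding E_def by blast
    then show ?thesis using B(2) by blast
  qed
  have base: "\<exists>A. maximal_antichain P A"
    using maximal_antichain_exists[of P P] by blast
  have "\<exists>A. \<forall>n. maximal_antichain P (A n) \<and> (\<forall>b\<in>A (Suc n). \<exists>a\<in>A n. b \<le> a \<and> R b a)"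
    by (rule dependent_nat_choice) (use base step in blast)+
  then obtain A where A: "\<And>n. maximal_antichain P (A n)" and AR: "\<And>n b. b \<in> A (Suc n) \<Longrightarrow> \<exists>a\<in>A n. b \<le> a \<and> R b a"
    by blast
  note AP = MA_sub[OF A] and uniq = MA_uniq[OF A] and compat = MA_compat[OF A]
  have no_bound: False if r: "r \<in> P" and a: "\<And>n. a n \<in> A n \<and> r \<le> a n" for r a
  proof (rule no_chain[OF r, of a])
    fix n
    \<comment> \<open>The member of \<open>A n\<close> that \<open>a (Suc n)\<close> refines must be
      \<open>a n\<close>: both lie above \<open>r\<close>, and \<open>A n\<close> is an
      antichain.\<close>
    obtain a' where a': "a' \<in> A n" "a (Suc n) \<le> a'" "R (a (Suc n)) a'" using AR a by blast
    have "r \<le> a'" using a a'(2) order_trans by blast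
    then have "a' = a n" using uniq[OF a'(1) _ r] a by blast
    then show "a n \<in> P \<and> r \<le> a n \<and> R (a (Suc n)) (a n)" using a a' AP by blast
  qed
  define D where "D n = {p\<in>P. \<exists>a\<in>A n. p \<le> a}" for n
  have "open_dense P (D n)" for n
    unfolding open_dense_def D_def using compat[of _ n] by (auto; meson order_trans)
  moreover have "(\<Inter>n. D n) = {}"
  proof (rule ccontr)
    assume "(\<Inter>n. D n) \<noteq> {}"
    then obtain r where "\<And>n. r \<in> D n" by blast
    then have "r \<in> P" "\<forall>n. \<exists>a. a \<in> A n \<and> r \<le> a" unfolding D_def by blast+
    then show False using no_bound by metis
  qed
  moreover have "\<not> open_dense P {}" using ne unfolding open_dense_def by blast
  ultimately have nd: "\<not> omega_distributive P" unfolding omega_distributive_def by metis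
  \<comment> \<open>This name denotes the sequence whose \<open>n\<close>-th term is the unique
    member of \<open>A n\<close> in the generic filter. Its values are conditions, so any well-order
    of the whole type of conditions can serve as \<open>W\<close>.\<close>
  define \<tau> where "\<tau> n a = (if a \<in> A n then {a} else {})" for n a
  have forces: "forces_val P \<tau> p n a \<longleftrightarrow>
      (\<forall>q\<in>P. q \<le> p \<longrightarrow> (\<exists>r\<in>P. r \<le> q \<and> a \<in> A n \<and> r \<le> a))" for p n a
    unfolding forces_val_def \<tau>_def by auto
  obtain W :: "'p rel" where W: "Well_order W" "Field W = UNIV"
    using well_ordering[where 'a = 'p] by (elim exE conjE)
  have "omega_function_name P (Field W) \<tau>"
    unfolding omega_function_name_def
  proof (intro conjI allI ballI impI)
    show "\<tau> n a \<subseteq> P" for n a unfolding \<tau>_def using AP by auto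
    show "a \<in> Field W" for a using W by simp
    show "\<exists>q\<in>P. q \<le> p \<and> (\<exists>a\<in>Field W. forces_val P \<tau> q n a)" if p: "p \<in> P" for n p
    proof -
      obtain a r where ar: "a \<in> A n" "r \<in> P" "r \<le> p" "r \<le> a" using compat[OF p] by blast
      then have "forces_val P \<tau> r n a" unfolding forces by (meson order_trans order_refl)
      then show ?thesis using ar W by blast
    qed
    show "a = b" if p: "p \<in> P" and ab: "forces_val P \<tau> p n a \<and> forces_val P \<tau> p n b" for p n a b
    proof -
      obtain r where r: "r \<in> P" "r \<le> p" "a \<in> A n" "r \<le> a" using ab p unfolding forces by blast
      obtain r' where r': "r' \<in> P" "r' \<le> r" "b \<in> A n" "r' \<le> b" using ab r unfolding forces by blast
      have "r' \<le> a" using r r' by (meson order_trans)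
      then show ?thesis using uniq r r' by blast
    qed
  qed
  moreover have "\<not> (\<exists>p\<in>P. \<exists>g. \<forall>n. forces_val P \<tau> p n (g n))"
  proof
    assume "\<exists>p\<in>P. \<exists>g. \<forall>n. forces_val P \<tau> p n (g n)"
    then obtain p g where p: "p \<in> P" and g: "\<And>n. forces_val P \<tau> p n (g n)" by blast
    \<comment> \<open>If \<open>p\<close> decides the whole sequence, every condition below
      \<open>p\<close> is compatible with \<open>g n\<close>; separativity turns this into
      \<open>p \<le> g n\<close>.\<close>
    have "g n \<in> A n \<and> p \<le> g n" for n
    proof
      show "g n \<in> A n" using g[of n] p unfolding forces by blast
      then have "g n \<in> P" by (rule AP)
      then show "p \<le> g n" by (rule separative[OF p]) (use g[of n] in \<open>unfold forces, blast\<close>)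
    qed
    then show False using no_bound p by blast
  qed
  ultimately show ?thesis using nd W unfolding adds_new_omega_function_def by blast
qed

section \<open>Nodes and trees\<close>

lemma ht_eqI: "dom t = {..<\<alpha>} \<Longrightarrow> ht t = \<alpha>"
  unfolding ht_def by (rule the_equality) (auto simp: lessThan_eq_iff)

lemma nodesE:
  assumes "t \<in> nodes lam \<kappa>s"
  shows "dom t = {..<ht t}" "ht t < lam" "\<And>\<beta>. \<beta> < ht t \<Longrightarrow> the (t \<beta>) < \<kappa>s \<beta>"
proof -
  obtain \<alpha> where \<alpha>: "\<alpha> < lam" "dom t = {..<\<alpha>}" "\<forall>\<beta><\<alpha>. the (t \<beta>) < \<kappa>s \<beta>"
    using assms unfolding nodes_def by (elim CollectE exE conjE)
  have "ht t = \<alpha>" by (rule ht_eqI[OF \<alpha>(2)])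
  then show "dom t = {..<ht t}" "ht t < lam" "\<And>\<beta>. \<beta> < ht t \<Longrightarrow> the (t \<beta>) < \<kappa>s \<beta>"
    using \<alpha> by auto
qed

lemmas nodes_dom = nodesE(1) and nodes_ht = nodesE(2) and nodes_value = nodesE(3)

lemma nodes_Some: "t \<in> nodes lam \<kappa>s \<Longrightarrow> \<beta> < ht t \<Longrightarrow> t \<beta> = Some (the (t \<beta>))"
  using nodes_dom[of t lam \<kappa>s] by (metis domIff lessThan_iff option.collapse)

lemma nodesI:
  "dom t = {..<\<alpha>} \<Longrightarrow> \<alpha> < lam \<Longrightarrow> (\<And>\<beta>. \<beta> < \<alpha> \<Longrightarrow> the (t \<beta>) < \<kappa>s \<beta>) \<Longrightarrow> t \<in> nodes lam \<kappa>s"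
  unfolding nodes_def by blast

lemma ht_restrict: "t \<in> nodes lam \<kappa>s \<Longrightarrow> \<xi> \<le> ht t \<Longrightarrow> ht (t |` {..<\<xi>}) = \<xi>"
  by (rule ht_eqI) (use nodes_dom[of t] in auto)

lemma restrict_nodes:
  assumes "t \<in> nodes lam \<kappa>s" "\<xi> \<le> ht t"
  shows "t |` {..<\<xi>} \<in> nodes lam \<kappa>s"
proof (rule nodesI)
  show "dom (t |` {..<\<xi>}) = {..<\<xi>}" using nodes_dom[OF assms(1)] assms(2) by auto
  show "\<xi> < lam" using assms nodes_ht le_less_trans by blast
  show "the ((t |` {..<\<xi>}) \<beta>) < \<kappa>s \<beta>" if "\<beta> < \<xi>" for \<beta>
    using that assms nodes_value[OF assms(1)] by auto
qed

lemma restrict_map_le: "t |` X \<subseteq>\<^sub>m t"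
  by (auto simp: map_le_def)

lemma map_le_iff_restrict:
  assumes "s \<in> nodes lam \<kappa>s" "t \<in> nodes lam \<kappa>s"
  shows "s \<subseteq>\<^sub>m t \<longleftrightarrow> ht s \<le> ht t \<and> s = t |` {..<ht s}"
proof
  assume le: "s \<subseteq>\<^sub>m t"
  then have "dom s \<subseteq> dom t" by (rule map_le_implies_dom_le)
  then have 1: "ht s \<le> ht t" using assms by (simp add: nodes_dom lessThan_subset_iff)
  have "s x = (t |` {..<ht s}) x" for x
  proof (cases "x < ht s")
    case True
    then have "x \<in> dom s" using nodes_dom[OF assms(1)] by simp
    then show ?thesis using le True unfolding map_le_def by simp
  next
    case False
    then have "x \<notin> dom s" using nodes_dom[OF assms(1)] by simp
    then show ?thesis using False by (simp add: domIff)
  qed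
  then show "ht s \<le> ht t \<and> s = t |` {..<ht s}" using 1 by blast
next
  assume "ht s \<le> ht t \<and> s = t |` {..<ht s}"
  then show "s \<subseteq>\<^sub>m t" using restrict_map_le by metis
qed

lemma restrict_restrict_lessThan:
  fixes \<xi> :: "'o::linorder"
  shows "\<xi> \<le> \<eta> \<Longrightarrow> (t |` {..<\<eta>}) |` {..<\<xi>} = t |` {..<\<xi>}"
  by (simp add: Int_absorb1 lessThan_subset_iff)

lemma is_tree_node: "is_tree lam \<kappa>s T \<Longrightarrow> t \<in> T \<Longrightarrow> t \<in> nodes lam \<kappa>s"
  unfolding is_tree_def by blast

lemma is_tree_initial:
  "is_tree lam \<kappa>s T \<Longrightarrow> t \<in> T \<Longrightarrow> s \<in> nodes lam \<kappa>s \<Longrightarrow> s \<subseteq>\<^sub>m t \<Longrightarrow> s \<in> T"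
  unfolding is_tree_def by simp

lemma is_tree_restrict:
  "is_tree lam \<kappa>s T \<Longrightarrow> t \<in> T \<Longrightarrow> \<xi> \<le> ht t \<Longrightarrow> t |` {..<\<xi>} \<in> T"
  by (rule is_tree_initial[OF _ _ restrict_nodes restrict_map_le]) (auto intro: is_tree_node)

lemma OSucc_mono: "q \<subseteq> p \<Longrightarrow> OSucc q t \<subseteq> OSucc p t"
  unfolding OSucc_def by blast

lemma Succ_eqpoll_OSucc: "Succ T t \<approx> OSucc T t"
proof -
  have "inj_on (snoc t) (OSucc T t)"
    unfolding snoc_def by (rule inj_onI) (metis map_upd_Some_unfold option.inject)
  then show ?thesis unfolding Succ_def by (rule inj_on_image_eqpoll_self)
qed

text \<open>
  Selecting the least element of a well-ordering makes the choices along an initial segment of a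
  branch agree, so that a selected extension is actually reached, also through limit levels.
\<close>

lemma coherent_choice:
  "\<exists>m :: 'a set \<Rightarrow> 'a. \<forall>X. X \<noteq> {} \<longrightarrow> m X \<in> X \<and> (\<forall>Y\<subseteq>X. m X \<in> Y \<longrightarrow> m Y = m X)"
proof -
  obtain r :: "'a rel" where r: "Well_order r" "Field r = UNIV"
    using well_ordering[where 'a = 'a] by (elim exE conjE)
  have wf: "wf (r - Id)" using r unfolding well_order_on_def by simp
  have total: "(x, y) \<in> r \<or> (y, x) \<in> r" if "x \<noteq> y" for x y
    using r that unfolding well_order_on_def linear_order_on_def total_on_def by simp
  have "\<exists>x. x \<in> X \<and> (\<forall>y\<in>X. (x, y) \<in> r \<or> y = x)" if "X \<noteq> {}" for X
  proof -
    obtain x where x: "x \<in> X" "\<And>y. (y, x) \<in> r - Id \<Longrightarrow> y \<notin> X"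
      using wf \<open>X \<noteq> {}\<close> unfolding wf_eq_minimal by (meson ex_in_conv)
    have "(x, y) \<in> r \<or> y = x" if "y \<in> X" for y
      using x(2)[of y] total[of x y] that by auto
    then show ?thesis using x(1) by blast
  qed
  then obtain m where m: "\<And>X. X \<noteq> {} \<Longrightarrow> m X \<in> X \<and> (\<forall>y\<in>X. (m X, y) \<in> r \<or> y = m X)"
    by metis
  have antisym: "antisym r"
    using r unfolding well_order_on_def linear_order_on_def partial_order_on_def by simp
  have "m Y = m X" if "X \<noteq> {}" "Y \<subseteq> X" "m X \<in> Y" for X Y
  proof (rule ccontr)
    assume ne: "m Y \<noteq> m X"
    have "Y \<noteq> {}" using that(3) by auto
    then have mY: "m Y \<in> Y" "(m Y, m X) \<in> r" using m[of Y] that(3) ne by metis+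
    have "(m X, m Y) \<in> r" using m[OF that(1)] that(2) mY(1) ne by (meson subsetD)
    then show False using antisymD[OF antisym mY(2)] ne by simp
  qed
  then show ?thesis using m by meson
qed

section \<open>Splitting nodes and skipping\<close>

definition splits :: "('o::wellorder \<rightharpoonup> 'o) set \<Rightarrow> ('o \<rightharpoonup> 'o) \<Rightarrow> bool" where
  "splits T t \<longleftrightarrow> t \<in> T \<and> (\<exists>\<beta>\<in>OSucc T t. \<exists>\<gamma>\<in>OSucc T t. \<beta> \<noteq> \<gamma>)"

lemma splits_mono: "q \<subseteq> p \<Longrightarrow> splits q t \<Longrightarrow> splits p t"
  using OSucc_mono unfolding splits_def by blast

text \<open>Initial segments of \<open>t\<close> are given by their heights, so that a descending
  sequence of skipped nodes becomes a descending sequence of ordinals.\<close>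

definition skips :: "('o::wellorder \<rightharpoonup> 'o) set \<Rightarrow> ('o \<rightharpoonup> 'o) set \<Rightarrow> bool" where
  "skips q p \<longleftrightarrow> (\<forall>t. splits q t \<longrightarrow> (\<exists>\<xi><ht t. splits p (t |` {..<\<xi>}) \<and>
     (\<forall>\<eta><ht t. splits q (t |` {..<\<eta>}) \<longrightarrow> \<eta> < \<xi>)))"

lemma skips_chain_no_common_split:
  fixes a :: "nat \<Rightarrow> ('o::wellorder \<rightharpoonup> 'o) set"
  assumes skips: "\<And>n. skips (a (Suc n)) (a n)" and t: "\<And>n. splits (a n) t"
  shows False
proof -
  have "\<exists>\<xi>. \<xi> < ht t \<and> splits (a n) (t |` {..<\<xi>}) \<and>
     (\<forall>\<eta><ht t. splits (a (Suc n)) (t |` {..<\<eta>}) \<longrightarrow> \<eta> < \<xi>)" for n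
    using skips[of n] t[of "Suc n"] unfolding skips_def by blast
  then obtain \<xi> where \<xi>: "\<And>n. \<xi> n < ht t \<and> splits (a n) (t |` {..<\<xi> n}) \<and>
     (\<forall>\<eta><ht t. splits (a (Suc n)) (t |` {..<\<eta>}) \<longrightarrow> \<eta> < \<xi> n)"
    by metis
  \<comment> \<open>The initial segment of height \<open>\<xi> (Suc n)\<close> splits in
    \<open>a (Suc n)\<close>, hence is one of those that \<open>\<xi> n\<close> has to
    exceed.\<close>
  then have "\<xi> (Suc n) < \<xi> n" for n by blast
  then show False using wf_iff_no_infinite_down_chain[THEN iffD1, OF wf] by blast
qed

text \<open>
  Each of the three forcings has this form: \<open>Q\<close> is its extra requirement on successor sets, which
  for stationary and club trees already implies the cardinality requirement at high levels.
\<close>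

definition branching_trees ::
    "'o::wellorder \<Rightarrow> ('o \<Rightarrow> 'o) \<Rightarrow> ('o \<Rightarrow> 'o set \<Rightarrow> bool) \<Rightarrow> ('o \<rightharpoonup> 'o) set set" where
  "branching_trees lam \<kappa>s Q = {p. is_tree lam \<kappa>s p \<and> lt_closed lam p \<and>
     (\<forall>s\<in>p. \<forall>\<alpha><lam. \<exists>t\<in>p. s \<subseteq>\<^sub>m t \<and> {..<\<kappa>s \<alpha>} \<lesssim> OSucc p t \<and> Q (ht t) (OSucc p t))}"

locale node_tree =
  fixes lam :: "'o::wellorder" and \<kappa>s :: "'o \<Rightarrow> 'o"
  assumes limit_lam: "limit_ord lam"
    and mono_\<kappa>s: "\<And>\<alpha> \<beta>. \<alpha> \<le> \<beta> \<Longrightarrow> \<beta> < lam \<Longrightarrow> \<kappa>s \<alpha> \<le> \<kappa>s \<beta>"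
    and infinite_\<kappa>s: "\<And>\<alpha>. \<alpha> < lam \<Longrightarrow> infinite {..<\<kappa>s \<alpha>}"
begin

section \<open>Extensions of nodes\<close>

abbreviation "N \<equiv> nodes lam \<kappa>s"

text \<open>An arbitrary well-order has no successor function; below the limit \<open>lam\<close>,
  the least element above \<open>\<alpha>\<close> takes its place.\<close>

lemma successor_exists:
  assumes "\<alpha> < lam"
  obtains \<gamma> where "\<gamma> < lam" "{..<\<gamma>} = {..\<alpha>}"
proof -
  obtain \<beta> where \<beta>: "\<alpha> < \<beta>" "\<beta> < lam" using limit_lam assms unfolding limit_ord_def by blast
  define \<gamma> where "\<gamma> = (LEAST \<gamma>. \<alpha> < \<gamma>)"
  have "\<alpha> < \<gamma>" unfolding \<gamma>_def using \<beta>(1) by (rule LeastI)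
  moreover have le: "\<gamma> \<le> \<delta>" if "\<alpha> < \<delta>" for \<delta> unfolding \<gamma>_def using that by (rule Least_le)
  ultimately have "x < \<gamma> \<longleftrightarrow> x \<le> \<alpha>" for x by (meson leI leD le_less_trans)
  then have "{..<\<gamma>} = {..\<alpha>}" by auto
  moreover have "\<gamma> < lam" using le[OF \<beta>(1)] \<beta>(2) by simp
  ultimately show ?thesis using that by blast
qed

lemma dom_snoc: "t \<in> N \<Longrightarrow> dom (snoc t \<beta>) = {..ht t}"
  unfolding snoc_def using nodes_dom[of t] by auto

lemma snoc_nodes:
  assumes t: "t \<in> N" and \<beta>: "\<beta> < \<kappa>s (ht t)"
  shows "snoc t \<beta> \<in> N"
proof -
  obtain \<gamma> where \<gamma>: "\<gamma> < lam" "{..<\<gamma>} = {..ht t}" using successor_exists[OF nodes_ht[OF t]] .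
  show ?thesis
  proof (rule nodesI)
    show "dom (snoc t \<beta>) = {..<\<gamma>}" using dom_snoc[OF t] \<gamma> by simp
    show "\<gamma> < lam" by fact
    fix \<eta> assume "\<eta> < \<gamma>"
    then have "\<eta> \<le> ht t" using \<gamma> by auto
    then show "the (snoc t \<beta> \<eta>) < \<kappa>s \<eta>"
      using \<beta> nodes_value[OF t, of \<eta>] unfolding snoc_def by (cases "\<eta> = ht t") auto
  qed
qed

text \<open>The height of \<open>snoc t \<beta>\<close> is the successor of \<open>ht t\<close>; it
  is described by its predecessors instead of being named.\<close>

lemma lessThan_ht_snoc:
  assumes "t \<in> N" "snoc t \<beta> \<in> N"
  shows "\<xi> < ht (snoc t \<beta>) \<longleftrightarrow> \<xi> \<le> ht t"
  using nodes_dom[OF assms(2)] dom_snoc[OF assms(1)] by auto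

lemma snoc_value: "snoc t \<beta> (ht t) = Some \<beta>"
  unfolding snoc_def by simp

lemma snoc_value_below: "\<xi> < ht t \<Longrightarrow> snoc t \<beta> \<xi> = t \<xi>"
  unfolding snoc_def by auto

lemma restrict_snoc:
  assumes "\<xi> \<le> ht t"
  shows "snoc t \<beta> |` {..<\<xi>} = t |` {..<\<xi>}"
  using assms by (intro ext) (auto simp: restrict_map_def snoc_def)

lemma restrict_ht: "t \<in> N \<Longrightarrow> t |` {..<ht t} = t"
  using map_le_iff_restrict[of t lam \<kappa>s t] by simp

lemma map_le_snoc: "t \<in> N \<Longrightarrow> t \<subseteq>\<^sub>m snoc t \<beta>"
  using restrict_snoc[of "ht t" t \<beta>] restrict_ht[of t] restrict_map_le[of "snoc t \<beta>" "{..<ht t}"]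
  by simp

lemma OSucc_restrict:
  assumes T: "is_tree lam \<kappa>s T" and t: "t \<in> T" and \<xi>: "\<xi> < ht t"
  shows "the (t \<xi>) \<in> OSucc T (t |` {..<\<xi>})"
proof -
  have tN: "t \<in> N" using is_tree_node[OF T t] .
  have h: "ht (t |` {..<\<xi>}) = \<xi>" using ht_restrict[OF tN] \<xi> by simp
  have rN: "t |` {..<\<xi>} \<in> N" using restrict_nodes[OF tN] \<xi> by simp
  have tx: "t \<xi> = Some (the (t \<xi>))" using nodes_Some[OF tN \<xi>] .
  have "snoc (t |` {..<\<xi>}) (the (t \<xi>)) \<in> N"
    by (rule snoc_nodes[OF rN]) (simp add: h nodes_value[OF tN \<xi>])
  moreover have "snoc (t |` {..<\<xi>}) (the (t \<xi>)) \<subseteq>\<^sub>m t"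
    unfolding snoc_def h using tx by (auto simp: map_le_def)
  ultimately show ?thesis unfolding OSucc_def using is_tree_initial[OF T t] by simp
qed

lemma OSucc_nonempty:
  assumes T: "is_tree lam \<kappa>s T" and c: "lt_closed lam T" and t: "t \<in> T"
  shows "OSucc T t \<noteq> {}"
proof -
  obtain s where s: "s \<in> T" "t \<subseteq>\<^sub>m s" "s \<noteq> t" using c t unfolding lt_closed_def by blast
  have N: "s \<in> N" "t \<in> N" using is_tree_node[OF T] s t by auto
  have le: "ht t \<le> ht s" "t = s |` {..<ht t}" using map_le_iff_restrict[OF N(2,1)] s(2) by auto
  have "ht t \<noteq> ht s" using le(2) restrict_ht[OF N(1)] s(3) by metis
  then have "ht t < ht s" using le by simp
  then have "the (s (ht t)) \<in> OSucc T (s |` {..<ht t})" by (rule OSucc_restrict[OF T s(1)])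
  then show ?thesis using le(2) by auto
qed

text \<open>Continue \<open>t\<close> by one arbitrary successor after another. Closure keeps the
  branch inside \<open>T\<close> at limit levels, so it reaches every level below
  \<open>lam\<close>.\<close>

lemma high_extension:
  assumes T: "is_tree lam \<kappa>s T" and c: "lt_closed lam T" and t: "t \<in> T" and \<alpha>: "\<alpha> < lam"
  shows "\<exists>s\<in>T. t \<subseteq>\<^sub>m s \<and> \<alpha> \<le> ht s"
proof -
  \<comment> \<open>\<open>R f \<xi>\<close> is the branch \<open>f\<close> cut off to height
    \<open>\<xi>\<close>. The next value \<open>F f \<xi>\<close> depends on \<open>f\<close> only
    through this node, which justifies the recursion.\<close>
  define R where "R f \<xi> = (\<lambda>\<eta>. if \<eta> < \<xi> then Some (f \<eta>) else None)" for f :: "'o \<Rightarrow> 'o" and \<xi>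
  define F where "F f \<xi> = (if \<xi> < ht t then the (t \<xi>) else (SOME \<beta>. \<beta> \<in> OSucc T (R f \<xi>)))"
    for f \<xi>
  define f where "f = wfrec {(x, y). x < y} F"
  have f: "f \<xi> = F f \<xi>" for \<xi>
  proof -
    have "R (cut f {(x, y). x < y} \<xi>) \<xi> = R f \<xi>"
      unfolding R_def by (rule ext) (simp add: cut_apply)
    then have "F (cut f {(x, y). x < y} \<xi>) \<xi> = F f \<xi>" unfolding F_def by simp
    moreover have "f \<xi> = F (cut f {(x, y). x < y} \<xi>) \<xi>"
      unfolding f_def by (rule wfrec[OF wf])
    ultimately show ?thesis by simp
  qed
  have tN: "t \<in> N" using is_tree_node[OF T t] .
  have low: "R f \<xi> = t |` {..<\<xi>}" if "\<xi> \<le> ht t" for \<xi>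
  proof
    fix \<eta>
    have "t \<eta> = Some (the (t \<eta>))" if "\<eta> < ht t" using nodes_Some[OF tN that] .
    then show "R f \<xi> \<eta> = (t |` {..<\<xi>}) \<eta>"
      using that f[of \<eta>] unfolding R_def F_def restrict_map_def by auto
  qed
  have dom: "dom (R f \<xi>) = {..<\<xi>}" for \<xi> unfolding R_def by (auto split: if_splits)
  have RR: "R f \<xi> |` {..<\<eta>} = R f \<eta>" if "\<eta> \<le> \<xi>" for \<xi> \<eta>
    using that unfolding R_def restrict_map_def by (intro ext) auto
  have main: "R f \<xi> \<in> T" if "\<xi> < lam" for \<xi> using that
  proof (induction \<xi> rule: less_induct)
    case (less \<xi>)
    consider "\<xi> \<le> ht t" | "limit_ord \<xi>" | "ht t < \<xi>" "\<not> limit_ord \<xi>" by fastforce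
    then show ?case
    proof cases
      case 1
      then show ?thesis using low is_tree_restrict[OF T t] by simp
    next
      case 2
      have "\<forall>\<beta><\<xi>. R f \<xi> |` {..<\<beta>} \<in> T"
        using less RR by (metis less_imp_le less_trans)
      then show ?thesis using c less.prems 2 dom[of \<xi>] unfolding lt_closed_def by blast
    next
      case 3
      \<comment> \<open>Here \<open>\<xi>\<close> is the successor of some \<open>\<beta>\<close>
        with \<open>ht t \<le> \<beta>\<close>, so the value at \<open>\<beta>\<close> is a chosen
        successor and not a value of \<open>t\<close>.\<close>
      then obtain \<beta> where \<beta>: "\<beta> < \<xi>" "\<And>\<gamma>. \<beta> < \<gamma> \<Longrightarrow> \<not> \<gamma> < \<xi>" unfolding limit_ord_def by blast
      have le: "ht t \<le> \<beta>" using \<beta>(2)[of "ht t"] 3 by force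
      have "R f \<beta> \<in> T" using less \<beta>(1) by (meson less_trans)
      then have "f \<beta> \<in> OSucc T (R f \<beta>)"
        using f[of \<beta>] leD[OF le] OSucc_nonempty[OF T c] unfolding F_def by (simp add: some_in_eq)
      then have "snoc (R f \<beta>) (f \<beta>) \<in> T" unfolding OSucc_def by simp
      moreover have "snoc (R f \<beta>) (f \<beta>) = R f \<xi>"
      proof
        fix \<eta>
        have "\<eta> < \<xi> \<longleftrightarrow> \<eta> < \<beta> \<or> \<eta> = \<beta>" using \<beta> by (metis less_trans linorder_neqE)
        then show "snoc (R f \<beta>) (f \<beta>) \<eta> = R f \<xi> \<eta>"
          unfolding snoc_def ht_eqI[OF dom] using \<beta>(1) by (auto simp: R_def)
      qed
      ultimately show ?thesis by simp
    qed
  qed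
  define \<xi> where "\<xi> = max \<alpha> (ht t)"
  have "\<xi> < lam" unfolding \<xi>_def using \<alpha> nodes_ht[OF tN] by simp
  moreover have "t \<subseteq>\<^sub>m R f \<xi>"
    using restrict_map_le[of "R f \<xi>" "{..<ht t}"] RR[of "ht t" \<xi>] low[of "ht t"] restrict_ht[OF tN]
    unfolding \<xi>_def by simp
  moreover have "\<alpha> \<le> ht (R f \<xi>)" using ht_eqI[OF dom[of \<xi>]] unfolding \<xi>_def by simp
  ultimately show ?thesis using main by blast
qed

text \<open>The right-hand side consults \<open>\<Phi>\<close> only at proper initial segments of
  the node \<open>t\<close>, which have smaller height, so this is a well-founded recursion.\<close>

lemma recursive_selection:
  "\<exists>\<Phi>. \<forall>t\<in>N. \<Phi> t \<longleftrightarrow> (\<exists>\<xi><ht t. S t \<xi> \<and> (\<forall>\<eta><ht t. \<Phi> (t |` {..<\<eta>}) \<longrightarrow> \<eta> < \<xi>))"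
proof -
  define r :: "('o \<rightharpoonup> 'o) rel" where "r = inv_image {(x, y). x < y} ht"
  define G where "G \<Phi> t \<longleftrightarrow> (\<exists>\<xi><ht t. S t \<xi> \<and> (\<forall>\<eta><ht t. \<Phi> (t |` {..<\<eta>}) \<longrightarrow> \<eta> < \<xi>))" for \<Phi> t
  define \<Phi> where "\<Phi> = wfrec r G"
  have "wf r" unfolding r_def using wf by (rule wf_inv_image)
  then have \<Phi>: "\<Phi> t = G (cut \<Phi> r t) t" for t unfolding \<Phi>_def by (rule wfrec)
  have "\<Phi> t = G \<Phi> t" if t: "t \<in> N" for t
  proof -
    have "(t |` {..<\<eta>}, t) \<in> r" if "\<eta> < ht t" for \<eta>
      using ht_restrict[OF t] that unfolding r_def by simp
    then have "cut \<Phi> r t (t |` {..<\<eta>}) = \<Phi> (t |` {..<\<eta>})" if "\<eta> < ht t" for \<eta>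
      using that by (simp add: cut_apply)
    then have "G (cut \<Phi> r t) t = G \<Phi> t" unfolding G_def by simp
    then show ?thesis using \<Phi> by simp
  qed
  then show ?thesis unfolding G_def by blast
qed

text \<open>The least element of the type plays the role of the ordinal zero.\<close>

lemma ht_empty: "ht (Map.empty :: 'o \<rightharpoonup> 'o) = (LEAST x. True)"
  by (rule ht_eqI) (use not_less_Least in auto)

lemma empty_node: "Map.empty \<in> N"
proof (rule nodesI)
  show "dom (Map.empty :: 'o \<rightharpoonup> 'o) = {..<(LEAST x. True)}" using not_less_Least by auto
  obtain \<beta> where "\<beta> < lam" using limit_lam unfolding limit_ord_def by blast
  then show "(LEAST x. True) < lam" using Least_le[of "\<lambda>_. True" \<beta>] by simp
  show "the (Map.empty \<beta>) < \<kappa>s \<beta>" if "\<beta> < (LEAST x. True)" for \<beta>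
    using not_less_Least[OF that] by simp
qed

lemma is_tree_empty_node: "is_tree lam \<kappa>s T \<Longrightarrow> Map.empty \<in> T"
  using empty_node unfolding is_tree_def by (metis ex_in_conv map_le_empty)

lemma branching_splits:
  assumes "{..<\<kappa>s \<alpha>} \<lesssim> OSucc T t" "\<alpha> < lam" "t \<in> T"
  shows "splits T t"
proof -
  have "infinite (OSucc T t)"
    using infinite_\<kappa>s[OF assms(2)] assms(1) unfolding infinite_le_lepoll by (rule lepoll_trans)
  then have "\<not> is_singleton (OSucc T t)" "OSucc T t \<noteq> {}" by (auto simp: is_singleton_def)
  then obtain \<beta> \<gamma> where "\<beta> \<in> OSucc T t" "\<gamma> \<in> OSucc T t" "\<beta> \<noteq> \<gamma>"
    by (metis is_singletonI' )
  then show ?thesis unfolding splits_def using assms(3) by blast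
qed

section \<open>Skipping conditions and cones below a fixed condition\<close>

context
  fixes p :: "('o \<rightharpoonup> 'o) set" and Q :: "'o \<Rightarrow> 'o set \<Rightarrow> bool"
  assumes p: "p \<in> branching_trees lam \<kappa>s Q"
begin

lemma p_tree: "is_tree lam \<kappa>s p" and p_closed: "lt_closed lam p"
  and p_branching: "\<And>s \<alpha>. s \<in> p \<Longrightarrow> \<alpha> < lam \<Longrightarrow>
    \<exists>t\<in>p. s \<subseteq>\<^sub>m t \<and> {..<\<kappa>s \<alpha>} \<lesssim> OSucc p t \<and> Q (ht t) (OSucc p t)"
  using p unfolding branching_trees_def by simp_all

lemma p_node: "t \<in> p \<Longrightarrow> t \<in> N"
  using is_tree_node[OF p_tree] .

lemma p_split_above:
  assumes "t \<in> p"
  shows "\<exists>s. t \<subseteq>\<^sub>m s \<and> splits p s"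
  using p_branching[OF assms nodes_ht[OF p_node[OF assms]]] branching_splits
    nodes_ht[OF p_node[OF assms]] by blast

text \<open>The tree \<open>p\<close> is thinned so that it splits only at
  \<open>\<Phi>\<close>-nodes. Each of these has below it a splitting node of \<open>p\<close> that
  is above all earlier \<open>\<Phi>\<close>-nodes, as skipping requires, and it keeps all its
  successors in \<open>p\<close>, which preserves branching and \<open>Q\<close>.\<close>

lemma skipping_condition_exists:
  "\<exists>q\<in>branching_trees lam \<kappa>s Q. q \<subseteq> p \<and> skips q p"
proof -
  \<comment> \<open>The skipped level \<open>\<xi>\<close> also controls the number of successors.
    Along a branch it passes all earlier \<open>\<Phi>\<close>-nodes, so sufficiently high
    \<open>\<Phi>\<close>-nodes have at least \<open>\<kappa>s \<alpha>\<close> successors for any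
    given \<open>\<alpha>\<close>.\<close>
  obtain \<Phi> where \<Phi>: "\<And>t. t \<in> N \<Longrightarrow> \<Phi> t \<longleftrightarrow> (\<exists>\<xi><ht t.
      (splits p (t |` {..<\<xi>}) \<and> {..<\<kappa>s \<xi>} \<lesssim> OSucc p t \<and> Q (ht t) (OSucc p t)) \<and>
      (\<forall>\<eta><ht t. \<Phi> (t |` {..<\<eta>}) \<longrightarrow> \<eta> < \<xi>))"
    using recursive_selection[of "\<lambda>t \<xi>. splits p (t |` {..<\<xi>}) \<and> {..<\<kappa>s \<xi>} \<lesssim> OSucc p t \<and>
      Q (ht t) (OSucc p t)"] by metis
  obtain m :: "('o \<rightharpoonup> 'o) set \<Rightarrow> 'o \<rightharpoonup> 'o" where
    m: "\<And>X. X \<noteq> {} \<Longrightarrow> m X \<in> X \<and> (\<forall>Y\<subseteq>X. m X \<in> Y \<longrightarrow> m Y = m X)"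
    using coherent_choice by metis
  \<comment> \<open>\<open>q\<close> keeps all successors of the \<open>\<Phi>\<close>-nodes and elsewhere follows the path to a chosen one.\<close>
  define E where "E t = {u \<in> p. t \<subseteq>\<^sub>m u \<and> \<Phi> u}" for t
  define q where "q = {t \<in> p. \<forall>\<xi><ht t. \<Phi> (t |` {..<\<xi>}) \<or> t \<xi> = m (E (t |` {..<\<xi>})) \<xi>}"
  have qp: "q \<subseteq> p" unfolding q_def by blast
  have q_node: "t \<in> N" if "t \<in> q" for t using that qp p_node by blast
  \<comment> \<open>Above \<open>t\<close> take a splitting node \<open>s\<close>, then one of its
    successors, so that the next node \<open>u\<close> is strictly higher than \<open>s\<close>;
    choose \<open>u\<close> with \<open>Q\<close> and at least \<open>\<kappa>s (ht s)\<close>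
    successors. Unless some \<open>\<Phi>\<close>-node already lies between \<open>s\<close> and
    \<open>u\<close>, the level \<open>ht s\<close> witnesses \<open>\<Phi> u\<close>.\<close>
  have E_ne: "E t \<noteq> {}" if t: "t \<in> p" for t
  proof -
    obtain s where s: "t \<subseteq>\<^sub>m s" "splits p s" using p_split_above[OF t] by blast
    then obtain \<beta> where sp: "s \<in> p" and \<beta>: "snoc s \<beta> \<in> p" unfolding splits_def OSucc_def by blast
    note sN = p_node[OF sp]
    obtain u where u: "u \<in> p" "snoc s \<beta> \<subseteq>\<^sub>m u" "{..<\<kappa>s (ht s)} \<lesssim> OSucc p u" "Q (ht u) (OSucc p u)"
      using p_branching[OF \<beta> nodes_ht[OF sN]] by blast
    note uN = p_node[OF u(1)]
    have su: "s \<subseteq>\<^sub>m u" using map_le_snoc[OF sN] u(2) by (rule map_le_trans)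
    have hsu: "ht s < ht u"
    proof -
      have "ht (snoc s \<beta>) \<le> ht u" using map_le_iff_restrict[OF p_node[OF \<beta>] uN] u(2) by simp
      then show ?thesis using lessThan_ht_snoc[OF sN p_node[OF \<beta>], of "ht s"] by simp
    qed
    have us: "u |` {..<ht s} = s" using map_le_iff_restrict[OF sN uN] su by simp
    show ?thesis
    proof (cases "\<exists>\<eta>. ht s \<le> \<eta> \<and> \<eta> < ht u \<and> \<Phi> (u |` {..<\<eta>})")
      case True
      then obtain \<eta> where \<eta>: "ht s \<le> \<eta>" "\<eta> < ht u" "\<Phi> (u |` {..<\<eta>})" by blast
      have "u |` {..<\<eta>} \<in> p" using is_tree_restrict[OF p_tree u(1)] \<eta>(2) by simp
      moreover have "s \<subseteq>\<^sub>m u |` {..<\<eta>}"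
        using restrict_map_le[of "u |` {..<\<eta>}" "{..<ht s}"] us restrict_restrict_lessThan[OF \<eta>(1), of u]
        by simp
      then have "t \<subseteq>\<^sub>m u |` {..<\<eta>}" using s(1) map_le_trans by blast
      ultimately show ?thesis unfolding E_def using \<eta>(3) by blast
    next
      case False
      have "\<Phi> u"
        unfolding \<Phi>[OF uN] by (rule exI[of _ "ht s"]) (use False hsu us s(2) u in \<open>auto simp: not_le[symmetric]\<close>)
      moreover have "t \<subseteq>\<^sub>m u" using s(1) su by (rule map_le_trans)
      ultimately show ?thesis unfolding E_def using u(1) by blast
    qed
  qed
  have selected: "m (E t) \<in> q \<and> t \<subseteq>\<^sub>m m (E t) \<and> \<Phi> (m (E t))" if t: "t \<in> q" for t
  proof -
    define u where "u = m (E t)"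
    have tp: "t \<in> p" using t qp by blast
    have "u \<in> E t" unfolding u_def using m[OF E_ne[OF tp]] by (rule conjunct1)
    then have u: "u \<in> p" "t \<subseteq>\<^sub>m u" "\<Phi> u" unfolding E_def by auto
    have tu: "ht t \<le> ht u" "t = u |` {..<ht t}"
      using map_le_iff_restrict[OF p_node[OF tp] p_node[OF u(1)]] u(2) by auto
    have "\<Phi> (u |` {..<\<xi>}) \<or> u \<xi> = m (E (u |` {..<\<xi>})) \<xi>" if \<xi>: "\<xi> < ht u" for \<xi>
    proof (cases "\<xi> < ht t")
      case True
      have 1: "u |` {..<\<xi>} = t |` {..<\<xi>}"
        using restrict_restrict_lessThan[of \<xi> "ht t" u] tu(2) True by simp
      have 2: "u \<xi> = t \<xi>" using tu(2) True by (metis lessThan_iff restrict_in)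
      show ?thesis using t True unfolding q_def 1 2 by simp
    next
      case False
      have "t \<subseteq>\<^sub>m u |` {..<\<xi>}"
        using restrict_map_le[of "u |` {..<\<xi>}" "{..<ht t}"] tu
          restrict_restrict_lessThan[of "ht t" \<xi> u] False by simp
      \<comment> \<open>The set of candidates shrinks along the path to \<open>u\<close> but still
        contains \<open>u\<close>, so the coherent choice keeps selecting \<open>u\<close>.\<close>
      then have "E (u |` {..<\<xi>}) \<subseteq> E t" unfolding E_def using map_le_trans by blast
      moreover have "u \<in> E (u |` {..<\<xi>})" unfolding E_def using u restrict_map_le by simp
      ultimately have "m (E (u |` {..<\<xi>})) = u" using m[OF E_ne[OF tp]] unfolding u_def by blast
      then show ?thesis by simp
    qed
    then have "u \<in> q" unfolding q_def using u(1) by blast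
    then show ?thesis using u unfolding u_def by blast
  qed
  \<comment> \<open>Passing from \<open>u\<close> to a successor adds a requirement at level
    \<open>ht u\<close> only, and \<open>\<Phi> u\<close> satisfies it.\<close>
  have OSucc_q: "OSucc q u = OSucc p u" if u: "u \<in> q" "\<Phi> u" for u
  proof
    show "OSucc q u \<subseteq> OSucc p u" by (rule OSucc_mono[OF qp])
    note uN = q_node[OF u(1)]
    show "OSucc p u \<subseteq> OSucc q u"
    proof
      fix \<beta> assume "\<beta> \<in> OSucc p u"
      then have \<beta>: "snoc u \<beta> \<in> p" unfolding OSucc_def by simp
      have "\<Phi> (snoc u \<beta> |` {..<\<xi>}) \<or> snoc u \<beta> \<xi> = m (E (snoc u \<beta> |` {..<\<xi>})) \<xi>"
        if "\<xi> < ht (snoc u \<beta>)" for \<xi>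
      proof -
        have le: "\<xi> \<le> ht u" using that lessThan_ht_snoc[OF uN p_node[OF \<beta>]] by simp
        show ?thesis
        proof (cases "\<xi> = ht u")
          case True
          then show ?thesis using restrict_snoc[OF le] restrict_ht[OF uN] u(2) by simp
        next
          case False
          then have "\<xi> < ht u" using le by simp
          then show ?thesis
            using u(1) unfolding restrict_snoc[OF le] snoc_value_below[OF \<open>\<xi> < ht u\<close>] q_def by blast
        qed
      qed
      then show "\<beta> \<in> OSucc q u" unfolding OSucc_def q_def using \<beta> by blast
    qed
  qed
  have q_restrict: "t |` {..<\<alpha>} \<in> q" if t: "t \<in> q" and \<alpha>: "\<alpha> \<le> ht t" for t \<alpha>
  proof -
    have tp: "t \<in> p" using t qp by blast
    have h: "ht (t |` {..<\<alpha>}) = \<alpha>" using ht_restrict[OF p_node[OF tp] \<alpha>] .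
    have "\<Phi> (t |` {..<\<alpha>} |` {..<\<xi>}) \<or> (t |` {..<\<alpha>}) \<xi> = m (E (t |` {..<\<alpha>} |` {..<\<xi>})) \<xi>"
      if "\<xi> < \<alpha>" for \<xi>
      using t that \<alpha> unfolding restrict_restrict_lessThan[OF less_imp_le[OF that]] q_def by auto
    then show ?thesis unfolding q_def using h is_tree_restrict[OF p_tree tp \<alpha>] by simp
  qed
  have q_tree: "is_tree lam \<kappa>s q"
    unfolding is_tree_def
  proof (intro conjI ballI impI)
    have "Map.empty \<in> q"
      unfolding q_def using is_tree_empty_node[OF p_tree] ht_empty not_less_Least by auto
    then show "q \<noteq> {}" by blast
    show "q \<subseteq> N" using q_node by blast
    show "s \<in> q" if "t \<in> q" "s \<in> N" "s \<subseteq>\<^sub>m t" for s t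
      using map_le_iff_restrict[OF that(2) q_node[OF that(1)]] that q_restrict by metis
  qed
  have q_closed: "lt_closed lam q"
    unfolding lt_closed_def
  proof (intro conjI ballI allI impI)
    show "\<exists>s\<in>q. t \<subseteq>\<^sub>m s \<and> s \<noteq> t" if t: "t \<in> q" for t
    proof -
      define u where "u = m (E t)"
      have u: "u \<in> q" "t \<subseteq>\<^sub>m u" "\<Phi> u" using selected[OF t] unfolding u_def by auto
      have "OSucc q u \<noteq> {}" using OSucc_q[OF u(1,3)] OSucc_nonempty[OF p_tree p_closed] u(1) qp by blast
      then obtain \<beta> where \<beta>: "snoc u \<beta> \<in> q" unfolding OSucc_def by blast
      have "t \<subseteq>\<^sub>m snoc u \<beta>" using u(2) map_le_snoc[OF q_node[OF u(1)]] by (rule map_le_trans)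
      moreover have "snoc u \<beta> \<noteq> t"
      proof
        assume "snoc u \<beta> = t"
        then have "ht (snoc u \<beta>) \<le> ht u"
          using map_le_iff_restrict[OF q_node[OF t] q_node[OF u(1)]] u(2) by simp
        then show False
          using lessThan_ht_snoc[OF q_node[OF u(1)] q_node[OF \<beta>], of "ht u"] by simp
      qed
      ultimately show ?thesis using \<beta> by blast
    qed
    fix \<delta> f
    assume \<delta>: "\<delta> < lam" "limit_ord \<delta>" and f: "dom f = {..<\<delta>} \<and> (\<forall>\<beta><\<delta>. f |` {..<\<beta>} \<in> q)"
    have "f \<in> p" using p_closed \<delta> f qp unfolding lt_closed_def by (meson subsetD)
    have h: "ht f = \<delta>" using f by (simp add: ht_eqI)
    have "\<Phi> (f |` {..<\<xi>}) \<or> f \<xi> = m (E (f |` {..<\<xi>})) \<xi>" if \<xi>: "\<xi> < \<delta>" for \<xi>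
    proof -
      \<comment> \<open>The requirement at level \<open>\<xi>\<close> involves values of
        \<open>f\<close> up to \<open>\<xi>\<close> only, so it can be read off from an initial
        segment of some height \<open>\<beta>\<close> above \<open>\<xi>\<close>.\<close>
      obtain \<beta> where \<beta>: "\<xi> < \<beta>" "\<beta> < \<delta>" using \<delta>(2) \<xi> unfolding limit_ord_def by blast
      have fq: "f |` {..<\<beta>} \<in> q" using f \<beta>(2) by blast
      have hb: "ht (f |` {..<\<beta>}) = \<beta>" using ht_restrict[OF p_node[OF \<open>f \<in> p\<close>]] h \<beta>(2) by simp
      have fx: "(f |` {..<\<beta>}) \<xi> = f \<xi>" using \<beta>(1) by simp
      have "\<forall>\<xi><\<beta>. \<Phi> (f |` {..<\<beta>} |` {..<\<xi>}) \<or> (f |` {..<\<beta>}) \<xi> = m (E (f |` {..<\<beta>} |` {..<\<xi>})) \<xi>"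
        using fq hb unfolding q_def by simp
      then have "\<Phi> (f |` {..<\<beta>} |` {..<\<xi>}) \<or> (f |` {..<\<beta>}) \<xi> = m (E (f |` {..<\<beta>} |` {..<\<xi>})) \<xi>"
        using \<beta>(1) by blast
      then show ?thesis unfolding restrict_restrict_lessThan[OF less_imp_le[OF \<beta>(1)]] fx .
    qed
    then show "f \<in> q" unfolding q_def using \<open>f \<in> p\<close> h by blast
  qed
  have "\<exists>t\<in>q. s \<subseteq>\<^sub>m t \<and> {..<\<kappa>s \<alpha>} \<lesssim> OSucc q t \<and> Q (ht t) (OSucc q t)"
    if s: "s \<in> q" and \<alpha>: "\<alpha> < lam" for s \<alpha>
  proof -
    \<comment> \<open>The level witnessing a single \<open>\<Phi>\<close>-node above
      \<open>t\<close> might be too low. Therefore two \<open>\<Phi>\<close>-nodes \<open>u\<close>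
      and \<open>v\<close> are taken in a row above level \<open>\<alpha>\<close>: the level
      \<open>\<xi>\<close> that witnesses \<open>\<Phi> v\<close> exceeds \<open>ht u\<close>, hence
      also \<open>\<alpha>\<close>.\<close>
    obtain t where t: "t \<in> q" "s \<subseteq>\<^sub>m t" "\<alpha> \<le> ht t"
      using high_extension[OF q_tree q_closed s \<alpha>] by blast
    define u where "u = m (E t)"
    have u: "u \<in> q" "t \<subseteq>\<^sub>m u" "\<Phi> u" using selected[OF t(1)] unfolding u_def by auto
    obtain \<beta> where \<beta>: "snoc u \<beta> \<in> q"
      using OSucc_nonempty[OF q_tree q_closed u(1)] unfolding OSucc_def by blast
    define v where "v = m (E (snoc u \<beta>))"
    have v: "v \<in> q" "snoc u \<beta> \<subseteq>\<^sub>m v" "\<Phi> v" using selected[OF \<beta>] unfolding v_def by auto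
    note N = q_node[OF t(1)] q_node[OF u(1)] q_node[OF \<beta>] q_node[OF v(1)]
    have uv: "u \<subseteq>\<^sub>m v" using map_le_snoc[OF N(2)] v(2) by (rule map_le_trans)
    have vu: "v |` {..<ht u} = u" using map_le_iff_restrict[OF N(2,4)] uv by simp
    have "ht (snoc u \<beta>) \<le> ht v" using map_le_iff_restrict[OF N(3,4)] v(2) by simp
    then have huv: "ht u < ht v" using lessThan_ht_snoc[OF N(2,3), of "ht u"] by simp
    have htu: "ht t \<le> ht u" using map_le_iff_restrict[OF N(1,2)] u(2) by simp
    obtain \<xi> where \<xi>: "\<xi> < ht v" "{..<\<kappa>s \<xi>} \<lesssim> OSucc p v" "Q (ht v) (OSucc p v)"
      "\<forall>\<eta><ht v. \<Phi> (v |` {..<\<eta>}) \<longrightarrow> \<eta> < \<xi>"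
      using v(3) unfolding \<Phi>[OF N(4)] by blast
    have "ht u < \<xi>" using \<xi>(4) huv vu u(3) by simp
    then have "\<alpha> \<le> \<xi>" using t(3) htu by simp
    moreover have "\<xi> < lam" using \<xi>(1) nodes_ht[OF N(4)] by simp
    ultimately have "{..<\<kappa>s \<alpha>} \<subseteq> {..<\<kappa>s \<xi>}" using mono_\<kappa>s by simp
    then have "{..<\<kappa>s \<alpha>} \<lesssim> OSucc p v" using \<xi>(2) subset_imp_lepoll lepoll_trans by blast
    moreover have "s \<subseteq>\<^sub>m v" using t(2) u(2) uv by (meson map_le_trans)
    ultimately show ?thesis using v(1) \<xi>(3) OSucc_q[OF v(1,3)] by auto
  qed
  then have "q \<in> branching_trees lam \<kappa>s Q"
    unfolding branching_trees_def using q_tree q_closed by simp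
  moreover have "skips q p"
  proof -
    \<comment> \<open>Where \<open>\<Phi>\<close> fails, membership in \<open>q\<close> prescribes
      the next value as that of \<open>m (E t)\<close>, so at most one successor survives.\<close>
    have split_\<Phi>: "\<Phi> t" if t: "splits q t" for t
    proof (rule ccontr)
      assume no: "\<not> \<Phi> t"
      obtain \<beta> \<gamma> where tq: "t \<in> q" and \<beta>\<gamma>: "snoc t \<beta> \<in> q" "snoc t \<gamma> \<in> q" "\<beta> \<noteq> \<gamma>"
        using t unfolding splits_def OSucc_def by blast
      have "Some b = m (E t) (ht t)" if b: "snoc t b \<in> q" for b
      proof -
        have "ht t < ht (snoc t b)" using lessThan_ht_snoc[OF q_node[OF tq] q_node[OF b]] by simp
        then have "\<Phi> (snoc t b |` {..<ht t}) \<or> snoc t b (ht t) = m (E (snoc t b |` {..<ht t})) (ht t)"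
          using b unfolding q_def by blast
        then show ?thesis
          using no restrict_snoc[of "ht t" t b] restrict_ht[OF q_node[OF tq]] snoc_value[of t b] by simp
      qed
      then show False using \<beta>\<gamma> by (metis option.inject)
    qed
    show ?thesis
      unfolding skips_def
    proof (intro allI impI)
      fix t assume t: "splits q t"
      then have "t \<in> q" unfolding splits_def by simp
      \<comment> \<open>The level that witnesses \<open>\<Phi> t\<close> is above all earlier
        \<open>\<Phi>\<close>-nodes, in particular above all earlier splitting nodes of
        \<open>q\<close>.\<close>
      then show "\<exists>\<xi><ht t. splits p (t |` {..<\<xi>}) \<and> (\<forall>\<eta><ht t. splits q (t |` {..<\<eta>}) \<longrightarrow> \<eta> < \<xi>)"
        using split_\<Phi>[OF t] split_\<Phi> unfolding \<Phi>[OF q_node[OF \<open>t \<in> q\<close>]] by blast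
    qed
  qed
  ultimately show ?thesis using qp by blast
qed

text \<open>Above \<open>t\<close> nothing is removed from \<open>p\<close>, and every node of the
  cone extends to one above \<open>t\<close>, so the requirements can be met there. Cones serve to
  prove separativity.\<close>

lemma cone_condition:
  assumes t: "t \<in> p"
  defines "c \<equiv> {s \<in> p. s \<subseteq>\<^sub>m t \<or> t \<subseteq>\<^sub>m s}"
  shows "c \<in> branching_trees lam \<kappa>s Q"
proof -
  note tN = p_node[OF t]
  have extend: "\<exists>v\<in>c. t \<subseteq>\<^sub>m v \<and> s \<subseteq>\<^sub>m v" if "s \<in> c" for s
    using that t unfolding c_def by (auto intro: map_le_refl)
  have OSucc_c: "OSucc c v = OSucc p v" if v: "v \<in> p" "t \<subseteq>\<^sub>m v" for v
    unfolding OSucc_def c_def using map_le_trans[OF v(2) map_le_snoc[OF p_node[OF v(1)]]] by simp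
  have "is_tree lam \<kappa>s c"
    unfolding is_tree_def
  proof (intro conjI ballI impI)
    show "c \<noteq> {}" using t unfolding c_def by (auto intro: map_le_refl)
    show "c \<subseteq> N" unfolding c_def using p_node by blast
    show "s \<in> c" if u: "u \<in> c" and s: "s \<in> N" "s \<subseteq>\<^sub>m u" for u s
    proof -
      have up: "u \<in> p" using u unfolding c_def by simp
      have "s \<in> p" by (rule is_tree_initial[OF p_tree up s])
      moreover have "s \<subseteq>\<^sub>m t \<or> t \<subseteq>\<^sub>m s"
      proof (cases "u \<subseteq>\<^sub>m t")
        case True
        then show ?thesis using s(2) map_le_trans by blast
      next
        case False
        then have tu: "t \<subseteq>\<^sub>m u" using u unfolding c_def by simp
        have "t = u |` {..<ht t}" "s = u |` {..<ht s}"
          using map_le_iff_restrict[OF tN p_node[OF up]] map_le_iff_restrict[OF s(1) p_node[OF up]] tu s(2)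
          by simp_all
        then show ?thesis
          using restrict_restrict_lessThan[of "ht s" "ht t" u] restrict_restrict_lessThan[of "ht t" "ht s" u]
            restrict_map_le linear by metis
      qed
      ultimately show ?thesis unfolding c_def by simp
    qed
  qed
  moreover have "lt_closed lam c"
    unfolding lt_closed_def
  proof (intro conjI ballI allI impI)
    show "\<exists>w\<in>c. s \<subseteq>\<^sub>m w \<and> w \<noteq> s" if s: "s \<in> c" for s
    proof -
      obtain v where v: "v \<in> c" "t \<subseteq>\<^sub>m v" "s \<subseteq>\<^sub>m v" using extend[OF s] by blast
      have vp: "v \<in> p" using v(1) unfolding c_def by simp
      obtain w where w: "w \<in> p" "v \<subseteq>\<^sub>m w" "w \<noteq> v" using p_closed vp unfolding lt_closed_def by blast
      have "w \<in> c" unfolding c_def using w(1) map_le_trans[OF v(2) w(2)] by simp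
      moreover have "w \<noteq> s" using map_le_antisym[of v w] v(3) w(2,3) by blast
      moreover have "s \<subseteq>\<^sub>m w" using v(3) w(2) by (rule map_le_trans)
      ultimately show ?thesis by blast
    qed
    fix \<delta> f
    assume \<delta>: "\<delta> < lam" "limit_ord \<delta>" and f: "dom f = {..<\<delta>} \<and> (\<forall>\<beta><\<delta>. f |` {..<\<beta>} \<in> c)"
    have fp: "f \<in> p" using p_closed \<delta> f unfolding lt_closed_def c_def by blast
    note fN = p_node[OF fp]
    have h: "ht f = \<delta>" using f by (simp add: ht_eqI)
    have "f \<subseteq>\<^sub>m t \<or> t \<subseteq>\<^sub>m f"
    proof (cases "ht t < \<delta>")
      case True
      \<comment> \<open>Comparable nodes of the same height are equal, so this initial segment of
        \<open>f\<close> is \<open>t\<close>.\<close>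
      have "f |` {..<ht t} \<in> c" using f True by blast
      then have "f |` {..<ht t} \<subseteq>\<^sub>m t \<or> t \<subseteq>\<^sub>m f |` {..<ht t}" unfolding c_def by simp
      moreover have "f |` {..<ht t} \<in> N" "ht (f |` {..<ht t}) = ht t"
        using restrict_nodes[OF fN] ht_restrict[OF fN] h True by simp_all
      ultimately have "f |` {..<ht t} = t"
        using map_le_iff_restrict[of _ lam \<kappa>s] restrict_ht tN by metis
      then show ?thesis using restrict_map_le by metis
    next
      case False
      \<comment> \<open>Now \<open>\<delta> \<le> ht t\<close>: every proper initial segment of
        \<open>f\<close> is shorter than \<open>t\<close> and comparable with it, hence below
        it.\<close>
      have "f \<xi> = t \<xi>" if \<xi>: "\<xi> < \<delta>" for \<xi>
      proof -
        obtain \<beta> where \<beta>: "\<xi> < \<beta>" "\<beta> < \<delta>" using \<delta>(2) \<xi> unfolding limit_ord_def by blast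
        have rc: "f |` {..<\<beta>} \<in> c" using f \<beta>(2) by blast
        have rN: "f |` {..<\<beta>} \<in> N" "ht (f |` {..<\<beta>}) = \<beta>"
          using restrict_nodes[OF fN] ht_restrict[OF fN] h \<beta>(2) by simp_all
        have "\<not> t \<subseteq>\<^sub>m f |` {..<\<beta>}" using map_le_iff_restrict[OF tN rN(1)] rN(2) False \<beta>(2) by auto
        then have "f |` {..<\<beta>} \<subseteq>\<^sub>m t" using rc unfolding c_def by blast
        moreover have "\<xi> \<in> dom (f |` {..<\<beta>})" using nodes_dom[OF rN(1)] rN(2) \<beta>(1) by simp
        ultimately show ?thesis using \<beta>(1) unfolding map_le_def by (metis lessThan_iff restrict_in)
      qed
      then have "f \<subseteq>\<^sub>m t" using f unfolding map_le_def by simp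
      then show ?thesis by simp
    qed
    then show "f \<in> c" unfolding c_def using fp by simp
  qed
  moreover have "\<exists>u\<in>c. s \<subseteq>\<^sub>m u \<and> {..<\<kappa>s \<alpha>} \<lesssim> OSucc c u \<and> Q (ht u) (OSucc c u)"
    if s: "s \<in> c" and \<alpha>: "\<alpha> < lam" for s \<alpha>
  proof -
    obtain v where v: "v \<in> c" "t \<subseteq>\<^sub>m v" "s \<subseteq>\<^sub>m v" using extend[OF s] by blast
    have vp: "v \<in> p" using v(1) unfolding c_def by simp
    obtain u where u: "u \<in> p" "v \<subseteq>\<^sub>m u" "{..<\<kappa>s \<alpha>} \<lesssim> OSucc p u" "Q (ht u) (OSucc p u)"
      using p_branching[OF vp \<alpha>] by blast
    have tu: "t \<subseteq>\<^sub>m u" "s \<subseteq>\<^sub>m u" using v u(2) map_le_trans by blast+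
    have "u \<in> c" unfolding c_def using u(1) tu(1) by simp
    then show ?thesis using u tu OSucc_c[OF u(1) tu(1)] by auto
  qed
  ultimately show ?thesis unfolding branching_trees_def by simp
qed

end

theorem branching_trees_forcing:
  assumes ne: "branching_trees lam \<kappa>s Q \<noteq> {}"
  shows "\<not> omega_distributive (branching_trees lam \<kappa>s Q) \<and>
    adds_new_omega_function (branching_trees lam \<kappa>s Q)"
proof (rule not_distributive_and_adds_new_omega_function[where R = skips, OF ne])
  let ?P = "branching_trees lam \<kappa>s Q"
  show "\<exists>q\<in>?P. q \<subseteq> p \<and> skips q p" if "p \<in> ?P" for p
    using skipping_condition_exists[OF that] .
  show "skips q p'" if "skips q p" "p \<subseteq> p'" for p p' q
    using that splits_mono unfolding skips_def by blast
  show False if r: "r \<in> ?P" and a: "\<And>n::nat. a n \<in> ?P \<and> r \<subseteq> a n \<and> skips (a (Suc n)) (a n)" for r a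
  proof -
    obtain s where "s \<in> r" using p_tree[OF r] unfolding is_tree_def by blast
    then obtain t where "splits r t" using p_split_above[OF r] by blast
    \<comment> \<open>Splitting passes to larger trees, so a splitting node of the lower bound
      \<open>r\<close> splits in every \<open>a n\<close>.\<close>
    then have "\<And>n. splits (a n) t" using a splits_mono by blast
    then show False using skips_chain_no_common_split[of a t] a by blast
  qed
  show "p \<subseteq> a" if p: "p \<in> ?P" and a: "a \<in> ?P"
    and dense: "\<And>q. q \<in> ?P \<Longrightarrow> q \<subseteq> p \<Longrightarrow> \<exists>r\<in>?P. r \<subseteq> q \<and> r \<subseteq> a" for p a
  proof
    \<comment> \<open>Some condition \<open>r\<close> inside the cone of \<open>t\<close> is
      contained in \<open>a\<close>. A node of \<open>r\<close> that is at least as high as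
      \<open>t\<close> is comparable with \<open>t\<close> and so extends it; hence \<open>t\<close>
      is in \<open>r\<close> and in \<open>a\<close>.\<close>
    fix t assume t: "t \<in> p"
    obtain r where r: "r \<in> ?P" "r \<subseteq> {s \<in> p. s \<subseteq>\<^sub>m t \<or> t \<subseteq>\<^sub>m s}" "r \<subseteq> a"
      using dense[OF cone_condition[OF p t]] by blast
    have tN: "t \<in> N" using p_node[OF p t] .
    obtain s where s: "s \<in> r" using p_tree[OF r(1)] unfolding is_tree_def by blast
    obtain u where u: "u \<in> r" "ht t \<le> ht u"
      using high_extension[OF p_tree[OF r(1)] p_closed[OF r(1)] s nodes_ht[OF tN]] by blast
    have uN: "u \<in> N" using p_node[OF r(1) u(1)] .
    have "t \<subseteq>\<^sub>m u"
    proof (rule ccontr)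
      assume no: "\<not> t \<subseteq>\<^sub>m u"
      then have "u \<subseteq>\<^sub>m t" using r(2) u(1) by blast
      then have "ht u = ht t" "u = t |` {..<ht u}" using map_le_iff_restrict[OF uN tN] u(2) by auto
      then have "u = t" using restrict_ht[OF tN] by simp
      then show False using no by (simp add: map_le_refl)
    qed
    then have "t \<in> r" using is_tree_initial[OF p_tree[OF r(1)] u(1) tN] by blast
    then show "t \<in> a" using r(3) by blast
  qed
qed

text \<open>This shows that the forcings are nonempty. Demanding \<open>Q\<close> from a level
  \<open>\<gamma>\<close> on suffices, because every node of the tree extends beyond that
  level.\<close>

lemma product_tree_condition:
  assumes S: "\<And>\<xi>. \<xi> < lam \<Longrightarrow> S \<xi> \<subseteq> {..<\<kappa>s \<xi>}" "\<And>\<xi>. \<xi> < lam \<Longrightarrow> S \<xi> \<noteq> {}"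
    and \<gamma>: "\<gamma> < lam"
    and Q: "\<And>\<xi>. \<gamma> \<le> \<xi> \<Longrightarrow> \<xi> < lam \<Longrightarrow> {..<\<kappa>s \<xi>} \<lesssim> S \<xi> \<and> Q \<xi> (S \<xi>)"
  shows "{t \<in> N. \<forall>\<xi><ht t. the (t \<xi>) \<in> S \<xi>} \<in> branching_trees lam \<kappa>s Q" (is "?T \<in> _")
proof -
  have OSucc_T: "OSucc ?T t = S (ht t)" if t: "t \<in> ?T" for t
  proof -
    have tN: "t \<in> N" using t by simp
    have "snoc t \<beta> \<in> ?T \<longleftrightarrow> \<beta> \<in> S (ht t)" for \<beta>
    proof
      assume b: "snoc t \<beta> \<in> ?T"
      then have "ht t < ht (snoc t \<beta>)" using lessThan_ht_snoc[OF tN] by simp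
      then have "the (snoc t \<beta> (ht t)) \<in> S (ht t)" using b by blast
      then show "\<beta> \<in> S (ht t)" by (simp add: snoc_value)
    next
      assume b: "\<beta> \<in> S (ht t)"
      then have bN: "snoc t \<beta> \<in> N" using snoc_nodes[OF tN] S(1)[OF nodes_ht[OF tN]] by blast
      have "the (snoc t \<beta> \<xi>) \<in> S \<xi>" if "\<xi> < ht (snoc t \<beta>)" for \<xi>
      proof (cases "\<xi> = ht t")
        case True
        then show ?thesis using b by (simp add: snoc_value)
      next
        case False
        then have "\<xi> < ht t" using that lessThan_ht_snoc[OF tN bN] by simp
        then show ?thesis using t by (simp add: snoc_value_below)
      qed
      then show "snoc t \<beta> \<in> ?T" using bN by simp
    qed
    then show ?thesis unfolding OSucc_def by simp
  qed
  have T_tree: "is_tree lam \<kappa>s ?T"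
    unfolding is_tree_def
  proof (intro conjI ballI impI)
    have "Map.empty \<in> ?T" using empty_node ht_empty not_less_Least by auto
    then show "?T \<noteq> {}" by blast
    show "?T \<subseteq> N" by blast
    show "s \<in> ?T" if t: "t \<in> ?T" and s: "s \<in> N" "s \<subseteq>\<^sub>m t" for s t
    proof -
      have le: "ht s \<le> ht t" "s = t |` {..<ht s}" using map_le_iff_restrict[OF s(1)] t s(2) by auto
      have "the (s \<xi>) \<in> S \<xi>" if \<xi>: "\<xi> < ht s" for \<xi>
      proof -
        have "s \<xi> = t \<xi>" using le(2) \<xi> by (metis lessThan_iff restrict_in)
        then show ?thesis using t le(1) \<xi> by simp
      qed
      then show ?thesis using s(1) by simp
    qed
  qed
  have T_closed: "lt_closed lam ?T"
    unfolding lt_closed_def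
  proof (intro conjI ballI allI impI)
    show "\<exists>s\<in>?T. t \<subseteq>\<^sub>m s \<and> s \<noteq> t" if t: "t \<in> ?T" for t
    proof -
      have tN: "t \<in> N" using t by simp
      obtain \<beta> where b: "snoc t \<beta> \<in> ?T"
        using S(2)[OF nodes_ht[OF tN]] OSucc_T[OF t] unfolding OSucc_def by blast
      then have "ht t < ht (snoc t \<beta>)" using lessThan_ht_snoc[OF tN] by simp
      then have "snoc t \<beta> \<noteq> t" by auto
      then show ?thesis using b map_le_snoc[OF tN] by blast
    qed
    fix \<delta> f
    assume \<delta>: "\<delta> < lam" "limit_ord \<delta>" and f: "dom f = {..<\<delta>} \<and> (\<forall>\<beta><\<delta>. f |` {..<\<beta>} \<in> ?T)"
    have h: "ht f = \<delta>" using f by (simp add: ht_eqI)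
    have val: "the (f \<xi>) < \<kappa>s \<xi> \<and> the (f \<xi>) \<in> S \<xi>" if \<xi>: "\<xi> < \<delta>" for \<xi>
    proof -
      obtain \<beta> where \<beta>: "\<xi> < \<beta>" "\<beta> < \<delta>" using \<delta>(2) \<xi> unfolding limit_ord_def by blast
      have fT: "f |` {..<\<beta>} \<in> ?T" using f \<beta>(2) by blast
      have "dom (f |` {..<\<beta>}) = {..<\<beta>}" using f \<beta>(2) by auto
      then have hb: "ht (f |` {..<\<beta>}) = \<beta>" by (rule ht_eqI)
      have "the ((f |` {..<\<beta>}) \<xi>) < \<kappa>s \<xi>"
        by (rule nodes_value[of _ lam]) (use fT hb \<beta>(1) in simp_all)
      moreover have "the ((f |` {..<\<beta>}) \<xi>) \<in> S \<xi>" using fT hb \<beta>(1) by simp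
      ultimately show ?thesis using \<beta>(1) by simp
    qed
    have "f \<in> N" using nodesI[of f \<delta>] f \<delta>(1) val by blast
    then show "f \<in> ?T" using val h by simp
  qed
  have "\<exists>t\<in>?T. s \<subseteq>\<^sub>m t \<and> {..<\<kappa>s \<alpha>} \<lesssim> OSucc ?T t \<and> Q (ht t) (OSucc ?T t)"
    if s: "s \<in> ?T" and \<alpha>: "\<alpha> < lam" for s \<alpha>
  proof -
    have "max \<alpha> \<gamma> < lam" using \<alpha> \<gamma> by simp
    then obtain t where t: "t \<in> ?T" "s \<subseteq>\<^sub>m t" "max \<alpha> \<gamma> \<le> ht t"
      using high_extension[OF T_tree T_closed s] by blast
    have lam: "ht t < lam" using t(1) nodes_ht by blast
    have "{..<\<kappa>s \<alpha>} \<subseteq> {..<\<kappa>s (ht t)}" using mono_\<kappa>s[OF _ lam] t(3) by simp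
    then have "{..<\<kappa>s \<alpha>} \<lesssim> S (ht t)" "Q (ht t) (S (ht t))"
      using Q[OF _ lam] t(3) subset_imp_lepoll lepoll_trans by (simp, blast, simp)
    then show ?thesis using t(1,2) OSucc_T[OF t(1)] by auto
  qed
  then show ?thesis unfolding branching_trees_def using T_tree T_closed by simp
qed

section \<open>The three forcings in the common form\<close>

lemma M_forcing_eq: "M_forcing lam \<kappa>s = branching_trees lam \<kappa>s (\<lambda>_ _. True)"
proof -
  have "{..<\<kappa>s \<alpha>} \<lesssim> Succ T t \<longleftrightarrow> {..<\<kappa>s \<alpha>} \<lesssim> OSucc T t"
    for \<alpha> t and T :: "('o \<rightharpoonup> 'o) set"
    using lepoll_trans2[OF _ Succ_eqpoll_OSucc] lepoll_trans2[OF _ eqpoll_sym[OF Succ_eqpoll_OSucc]]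
    by (rule iffI)
  then show ?thesis
    unfolding M_forcing_def branching_trees_def perfect_tree_def ever_branching_def by simp
qed

text \<open>Extending a node first to height at least \<open>\<alpha>\<close> and then to a node
  with \<open>Q\<close> meets both demands at one node, since \<open>Q\<close> at a level
  \<open>\<xi> \<ge> \<alpha>\<close> provides at least \<open>\<kappa>s \<xi>\<close>
  successors.\<close>

lemma perfect_trees_eq_branching_trees:
  assumes Q: "\<And>\<xi> X. \<xi> < lam \<Longrightarrow> Q \<xi> X \<Longrightarrow> {..<\<kappa>s \<xi>} \<lesssim> X"
  shows "{p. perfect_tree lam \<kappa>s p \<and> (\<forall>s\<in>p. \<exists>t\<in>p. s \<subseteq>\<^sub>m t \<and> Q (ht t) (OSucc p t))} =
    branching_trees lam \<kappa>s Q"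
proof -
  have M: "perfect_tree lam \<kappa>s p \<longleftrightarrow> p \<in> branching_trees lam \<kappa>s (\<lambda>_ _. True)" for p
    using M_forcing_eq unfolding M_forcing_def by blast
  have "p \<in> branching_trees lam \<kappa>s Q"
    if p: "perfect_tree lam \<kappa>s p" and pQ: "\<forall>s\<in>p. \<exists>t\<in>p. s \<subseteq>\<^sub>m t \<and> Q (ht t) (OSucc p t)" for p
  proof -
    have tree: "is_tree lam \<kappa>s p" "lt_closed lam p" using p unfolding perfect_tree_def by simp_all
    have "\<exists>t\<in>p. s \<subseteq>\<^sub>m t \<and> {..<\<kappa>s \<alpha>} \<lesssim> OSucc p t \<and> Q (ht t) (OSucc p t)"
      if s: "s \<in> p" and \<alpha>: "\<alpha> < lam" for s \<alpha>
    proof -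
      obtain u where u: "u \<in> p" "s \<subseteq>\<^sub>m u" "\<alpha> \<le> ht u" using high_extension[OF tree s \<alpha>] by blast
      obtain t where t: "t \<in> p" "u \<subseteq>\<^sub>m t" "Q (ht t) (OSucc p t)" using pQ u(1) by blast
      have N: "u \<in> N" "t \<in> N" using is_tree_node[OF tree(1)] u(1) t(1) by simp_all
      have "\<alpha> \<le> ht t" using map_le_iff_restrict[OF N] t(2) u(3) order_trans by blast
      then have "{..<\<kappa>s \<alpha>} \<subseteq> {..<\<kappa>s (ht t)}" using mono_\<kappa>s nodes_ht[OF N(2)] by simp
      then have "{..<\<kappa>s \<alpha>} \<lesssim> OSucc p t"
        using Q[OF nodes_ht[OF N(2)] t(3)] subset_imp_lepoll lepoll_trans by blast
      then show ?thesis using t(1,3) map_le_trans[OF u(2) t(2)] by blast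
    qed
    then show ?thesis unfolding branching_trees_def using tree by simp
  qed
  moreover have "perfect_tree lam \<kappa>s p \<and> (\<forall>s\<in>p. \<exists>t\<in>p. s \<subseteq>\<^sub>m t \<and> Q (ht t) (OSucc p t))"
    if p: "p \<in> branching_trees lam \<kappa>s Q" for p
  proof
    show "perfect_tree lam \<kappa>s p"
      unfolding M using p_tree[OF p] p_closed[OF p] p_branching[OF p] unfolding branching_trees_def by blast
    show "\<forall>s\<in>p. \<exists>t\<in>p. s \<subseteq>\<^sub>m t \<and> Q (ht t) (OSucc p t)"
      using p_branching[OF p] nodes_ht[OF p_node[OF p]] by blast
  qed
  ultimately show ?thesis by blast
qed

end

section \<open>Cofinality, clubs and stationary sets\<close>

lemma regular_cardinal_bounded:
  assumes "regular_cardinal \<mu>" "\<nu> < \<mu>" "\<forall>\<xi><\<nu>. f \<xi> < \<mu>"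
  shows "\<exists>y<\<mu>. \<forall>\<xi><\<nu>. f \<xi> < y"
proof -
  have "\<nu> < cofinality \<mu>" using assms(1,2) unfolding regular_cardinal_def by simp
  then have "\<not> (\<exists>f. (\<forall>\<xi><\<nu>. f \<xi> < \<mu>) \<and> (\<forall>y<\<mu>. \<exists>\<xi><\<nu>. y \<le> f \<xi>))"
    unfolding cofinality_def by (rule not_less_Least)
  then have "\<not> (\<forall>y<\<mu>. \<exists>\<xi><\<nu>. y \<le> f \<xi>)" using assms(3) by blast
  then show ?thesis by (simp add: not_le)
qed

text \<open>Distinct elements of \<open>C\<close> are chosen by recursion along
  \<open>\<mu>\<close>: at stage \<open>\<xi>\<close> the earlier values are bounded by regularity,
  and \<open>C\<close> has an element beyond the bound.\<close>

lemma unbounded_lepoll: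
  fixes C :: "'o::wellorder set"
  assumes reg: "regular_cardinal \<mu>" and C: "C \<subseteq> {..<\<mu>}" and unb: "\<And>\<beta>. \<beta> < \<mu> \<Longrightarrow> \<exists>\<gamma>\<in>C. \<beta> \<le> \<gamma>"
  shows "{..<\<mu>} \<lesssim> C"
proof -
  define F where "F f \<xi> = (SOME c. c \<in> C - f ` {..<\<xi>})" for f :: "'o \<Rightarrow> 'o" and \<xi>
  define f where "f = wfrec {(x, y). x < y} F"
  have f: "f \<xi> = F f \<xi>" for \<xi>
  proof -
    have "cut f {(x, y). x < y} \<xi> ` {..<\<xi>} = f ` {..<\<xi>}"
      by (rule image_cong) (simp_all add: cut_apply)
    then have "F (cut f {(x, y). x < y} \<xi>) \<xi> = F f \<xi>" unfolding F_def by simp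
    moreover have "f \<xi> = F (cut f {(x, y). x < y} \<xi>) \<xi>"
      unfolding f_def by (rule wfrec[OF wf])
    ultimately show ?thesis by simp
  qed
  have new: "f \<xi> \<in> C - f ` {..<\<xi>}" if "\<xi> < \<mu>" for \<xi> using that
  proof (induction \<xi> rule: less_induct)
    case (less \<xi>)
    have "f \<eta> < \<mu>" if "\<eta> < \<xi>" for \<eta>
      using less.IH[OF that] less.prems that C by (meson DiffD1 lessThan_iff less_trans subsetD)
    then obtain y where y: "y < \<mu>" "\<forall>\<eta><\<xi>. f \<eta> < y"
      using regular_cardinal_bounded[OF reg less.prems] by blast
    obtain \<gamma> where "\<gamma> \<in> C" "y \<le> \<gamma>" using unb[OF y(1)] by blast
    then have "\<gamma> \<in> C - f ` {..<\<xi>}" using y(2) by auto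
    then show ?case unfolding f[of \<xi>] F_def by (rule someI)
  qed
  have "f \<eta> \<noteq> f \<xi>" if "\<eta> < \<xi>" "\<xi> < \<mu>" for \<eta> \<xi> using new[OF that(2)] that(1) by (metis DiffD2 imageI lessThan_iff)
  then have "inj_on f {..<\<mu>}" by (metis inj_onI lessThan_iff linorder_neqE)
  moreover have "f ` {..<\<mu>} \<subseteq> C" using new by blast
  ultimately show ?thesis unfolding lepoll_def by blast
qed

lemma club_lepoll: "regular_cardinal \<mu> \<Longrightarrow> club_in \<mu> C \<Longrightarrow> {..<\<mu>} \<lesssim> C"
  unfolding club_in_def by (rule unbounded_lepoll) simp_all

lemma club_lessThan: "club_in \<mu> {..<\<mu>}"
  unfolding club_in_def by auto

text \<open>Every final segment of \<open>\<mu>\<close> is a club, so a stationary set meets it and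
  is therefore unbounded.\<close>

lemma stationary_lepoll:
  assumes reg: "regular_cardinal \<mu>" and S: "stationary_in \<mu> S"
  shows "{..<\<mu>} \<lesssim> S"
proof (rule unbounded_lepoll[OF reg])
  show "S \<subseteq> {..<\<mu>}" using S unfolding stationary_in_def by simp
  fix \<beta> assume \<beta>: "\<beta> < \<mu>"
  have "\<exists>\<gamma>\<in>{\<beta>..<\<mu>}. \<alpha> \<le> \<gamma>" if "\<alpha> < \<mu>" for \<alpha>
    using that \<beta> by (intro bexI[of _ "max \<alpha> \<beta>"]) auto
  moreover have "\<delta> \<in> {\<beta>..<\<mu>}"
    if \<delta>: "\<delta> < \<mu>" "limit_ord \<delta>" "\<forall>\<alpha><\<delta>. \<exists>\<gamma>\<in>{\<beta>..<\<mu>}. \<alpha> < \<gamma> \<and> \<gamma> < \<delta>" for \<delta>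
  proof -
    obtain \<gamma> where "\<beta> \<le> \<gamma>" "\<gamma> < \<delta>" using \<delta>(2,3) unfolding limit_ord_def by fastforce
    then show ?thesis using \<delta>(1) by simp
  qed
  moreover have "{\<beta>..<\<mu>} \<subseteq> {..<\<mu>}" by auto
  ultimately have "club_in \<mu> {\<beta>..<\<mu>}" unfolding club_in_def by blast
  then show "\<exists>\<gamma>\<in>S. \<beta> \<le> \<gamma>" using S unfolding stationary_in_def by fastforce
qed

section \<open>The points of cofinality omega\<close>

lemma omega_ord_le: "infinite {..<x} \<Longrightarrow> omega_ord \<le> x"
  unfolding omega_ord_def by (rule Least_le)

lemma finite_below_omega_ord: "\<nu> < omega_ord \<Longrightarrow> finite {..<\<nu>}"
  using omega_ord_le[of \<nu>] by (auto dest: leD)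

lemma infinite_omega_ord: "infinite {..<x} \<Longrightarrow> infinite {..<(omega_ord :: 'o::wellorder)}"
  for x :: "'o::wellorder"
  unfolding omega_ord_def by (rule LeastI)

text \<open>Composing with the map from \<open>\<xi>\<close> to \<open>card {..<\<xi>}\<close>
  re-indexes sequences on the natural numbers by the ordinals below \<open>omega_ord\<close>;
  unboundedness of this map preserves cofinality of increasing sequences.\<close>

lemma card_below_omega_ord_unbounded:
  assumes inf: "infinite {..<(omega_ord :: 'o::wellorder)}"
  shows "\<exists>\<xi><(omega_ord :: 'o). n \<le> card {..<\<xi>}"
proof -
  obtain S where S: "finite S" "card S = Suc n" "S \<subseteq> {..<(omega_ord :: 'o)}"
    using infinite_arbitrarily_large[OF inf] by blast
  have "S \<noteq> {}" using S(2) by auto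
  then have \<xi>: "Max S < omega_ord" using S(1,3) Max_in by blast
  have "S \<subseteq> insert (Max S) {..<Max S}" using S(1) Max_ge by (auto simp: less_le)
  then have "card S \<le> card (insert (Max S) {..<Max S})"
    by (rule card_mono[rotated]) (simp add: finite_below_omega_ord[OF \<xi>])
  then have "n \<le> card {..<Max S}" using S(2) finite_below_omega_ord[OF \<xi>] by simp
  then show ?thesis using \<xi> by blast
qed

text \<open>Inside a club choose a strictly increasing sequence of length omega. Its supremum stays
  below \<open>\<mu>\<close> by regularity, since \<open>\<mu>\<close> exceeds
  \<open>omega_ord\<close>; it belongs to the club as a limit of its points and has cofinality
  omega.\<close>

lemma stationary_cofinality_omega:
  fixes \<mu> :: "'o::wellorder"
  assumes reg: "regular_cardinal \<mu>" and \<omega>: "omega_ord < \<mu>"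
  shows "stationary_in \<mu> {\<beta>. \<beta> < \<mu> \<and> cofinality \<beta> = omega_ord}"
  unfolding stationary_in_def
proof (intro conjI allI impI)
  show "{\<beta>. \<beta> < \<mu> \<and> cofinality \<beta> = omega_ord} \<subseteq> {..<\<mu>}" by auto
  fix C assume C: "club_in \<mu> C"
  have "infinite {..<\<mu>}" using reg unfolding regular_cardinal_def infinite_cardinal_def by simp
  then have inf: "infinite {..<(omega_ord :: 'o)}" by (rule infinite_omega_ord)
  then obtain \<zeta> :: 'o where \<zeta>: "\<zeta> < omega_ord" by (metis finite.emptyI lessThan_iff ex_in_conv)
  have up: "\<exists>\<gamma>\<in>C. \<beta> < \<gamma>" if \<beta>: "\<beta> < \<mu>" for \<beta>
  proof -
    \<comment> \<open>Regularity applied to a constant function of length omega gives an element of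
      \<open>\<mu>\<close> strictly above \<open>\<beta>\<close>.\<close>
    obtain y where y: "y < \<mu>" "\<forall>\<xi><(omega_ord :: 'o). \<beta> < y"
      using regular_cardinal_bounded[OF reg \<omega>, of "\<lambda>_. \<beta>"] \<beta> by blast
    then obtain \<gamma> where "\<gamma> \<in> C" "y \<le> \<gamma>" using C unfolding club_in_def by blast
    then show ?thesis using y(2) \<zeta> by (meson less_le_trans)
  qed
  have C_less: "\<gamma> < \<mu>" if "\<gamma> \<in> C" for \<gamma> using C that unfolding club_in_def by blast
  have "\<exists>c. \<forall>n. c n \<in> C \<and> c n < c (Suc n)"
  proof (rule dependent_nat_choice)
    show "\<exists>x. x \<in> C" using up[OF \<omega>] by blast
    show "\<exists>y. y \<in> C \<and> x < y" if "x \<in> C" for x using up[OF C_less[OF that]] by blast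
  qed
  then obtain c where c: "\<And>n::nat. c n \<in> C" "\<And>n. c n < c (Suc n)" by blast
  have mono: "c m \<le> c n" if "m \<le> n" for m n
    using c(2) that by (simp add: lift_Suc_mono_le less_imp_le)
  obtain y where y: "y < \<mu>" "\<forall>\<xi><(omega_ord :: 'o). c (card {..<\<xi>}) < y"
    using regular_cardinal_bounded[OF reg \<omega>, of "\<lambda>\<xi>. c (card {..<\<xi>})"] C_less c(1) by blast
  have cy: "\<forall>n. c n < y"
  proof
    fix n
    obtain \<xi> :: 'o where "\<xi> < omega_ord" "n \<le> card {..<\<xi>}"
      using card_below_omega_ord_unbounded[OF inf] by blast
    then show "c n < y" using y(2) mono le_less_trans by blast
  qed
  \<comment> \<open>Since \<open>c\<close> is strictly increasing, its least strict upper bound is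
    its supremum.\<close>
  define \<delta> where "\<delta> = (LEAST y. \<forall>n. c n < y)"
  have \<delta>: "c n < \<delta>" for n unfolding \<delta>_def using LeastI[of "\<lambda>y. \<forall>n. c n < y", OF cy] by blast
  have "\<delta> \<le> y" unfolding \<delta>_def using cy by (rule Least_le)
  then have \<delta>\<mu>: "\<delta> < \<mu>" using y(1) by simp
  have below: "\<exists>n. \<beta> \<le> c n" if "\<beta> < \<delta>" for \<beta>
  proof -
    have "\<not> (\<forall>n. c n < \<beta>)" using that unfolding \<delta>_def by (rule not_less_Least)
    then show ?thesis using not_less by blast
  qed
  have cofinal: "\<exists>\<gamma>\<in>C. \<beta> < \<gamma> \<and> \<gamma> < \<delta>" if \<beta>: "\<beta> < \<delta>" for \<beta>
  proof -
    obtain n where "\<beta> \<le> c n" using below[OF \<beta>] by blast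
    then have "\<beta> < c (Suc n)" using c(2)[of n] by (rule le_less_trans)
    then show ?thesis using c(1) \<delta> by blast
  qed
  then have limit: "limit_ord \<delta>" unfolding limit_ord_def using \<delta> by blast
  then have "\<delta> \<in> C" using C \<delta>\<mu> cofinal unfolding club_in_def by blast
  moreover have "cofinality \<delta> = omega_ord"
    unfolding cofinality_def
  proof (rule Least_equality)
    have "\<exists>\<xi><(omega_ord :: 'o). \<beta> \<le> c (card {..<\<xi>})" if "\<beta> < \<delta>" for \<beta>
    proof -
      obtain n where n: "\<beta> \<le> c n" using below[OF \<open>\<beta> < \<delta>\<close>] by blast
      obtain \<xi> :: 'o where "\<xi> < omega_ord" "n \<le> card {..<\<xi>}"
        using card_below_omega_ord_unbounded[OF inf] by blast
      then show ?thesis using n mono order_trans by blast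
    qed
    then show "\<exists>f :: 'o \<Rightarrow> 'o. (\<forall>\<xi><omega_ord. f \<xi> < \<delta>) \<and> (\<forall>y<\<delta>. \<exists>\<xi><omega_ord. y \<le> f \<xi>)"
      using \<delta> by (intro exI[of _ "\<lambda>\<xi>. c (card {..<\<xi>})"] conjI allI impI)
    fix \<nu> :: 'o
    assume "\<exists>f :: 'o \<Rightarrow> 'o. (\<forall>\<xi><\<nu>. f \<xi> < \<delta>) \<and> (\<forall>y<\<delta>. \<exists>\<xi><\<nu>. y \<le> f \<xi>)"
    then obtain f where f: "\<forall>\<xi><\<nu>. f \<xi> < \<delta>" "\<forall>y<\<delta>. \<exists>\<xi><\<nu>. y \<le> f \<xi>" by blast
    show "omega_ord \<le> \<nu>"
    proof (rule ccontr)
      assume "\<not> omega_ord \<le> \<nu>"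
      \<comment> \<open>A function on an ordinal below omega has finite range. Its maximum lies
        below the limit \<open>\<delta>\<close>, so the function is not cofinal in
        \<open>\<delta>\<close>.\<close>
      then have fin: "finite (f ` {..<\<nu>})" by (simp add: finite_below_omega_ord)
      have ne: "f ` {..<\<nu>} \<noteq> {}" using f(2) \<delta> by blast
      have "Max (f ` {..<\<nu>}) < \<delta>" using Max_in[OF fin ne] f(1) by auto
      then obtain \<gamma> where \<gamma>: "Max (f ` {..<\<nu>}) < \<gamma>" "\<gamma> < \<delta>" using cofinal by blast
      then obtain \<xi> where "\<xi> < \<nu>" "\<gamma> \<le> f \<xi>" using f(2) by blast
      moreover have "f \<xi> \<le> Max (f ` {..<\<nu>})" using Max_ge[OF fin] \<open>\<xi> < \<nu>\<close> by simp
      ultimately show False using \<gamma>(1) by simp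
    qed
  qed
  ultimately show "{\<beta>. \<beta> < \<mu> \<and> cofinality \<beta> = omega_ord} \<inter> C \<noteq> {}" using \<delta>\<mu> by blast
qed

theorem theorem4p6:
  fixes \<kappa> lam :: "'o::wellorder" and \<kappa>s :: "'o \<Rightarrow> 'o"
  assumes "singular_cardinal \<kappa>"
    and "cofinality \<kappa> = lam"
    and "strict_mono_on {..<lam} \<kappa>s"
    and "\<forall>\<alpha><lam. regular_cardinal (\<kappa>s \<alpha>)"
    and "\<forall>\<xi>. (\<forall>\<alpha><lam. \<kappa>s \<alpha> \<le> \<xi>) \<longleftrightarrow> \<kappa> \<le> \<xi>"
  shows "\<forall>P \<in> {M_forcing lam \<kappa>s, M_club lam \<kappa>s, M_stat lam \<kappa>s}.
           \<not> omega_distributive P \<and> adds_new_omega_function P"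
proof -
  have reg: "regular_cardinal (\<kappa>s \<alpha>)" if "\<alpha> < lam" for \<alpha> using assms(4) that by blast
  have inf: "infinite {..<\<kappa>s \<alpha>}" if "\<alpha> < lam" for \<alpha>
    using reg[OF that] unfolding regular_cardinal_def infinite_cardinal_def by simp
  have less: "\<kappa>s \<alpha> < \<kappa>s \<beta>" if "\<alpha> < \<beta>" "\<beta> < lam" for \<alpha> \<beta>
    using strict_mono_onD[OF assms(3), of \<alpha> \<beta>] that by simp
  \<comment> \<open>If \<open>lam\<close> were zero, the supremum \<open>\<kappa>\<close> would be
    zero. If \<open>lam\<close> had a last element \<open>\<beta>\<close>, then
    \<open>\<kappa>\<close> would equal the regular cardinal \<open>\<kappa>s \<beta>\<close>,
    against singularity.\<close>
  have limit: "limit_ord lam"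
    unfolding limit_ord_def
  proof (intro conjI allI impI)
    show "\<exists>\<beta>. \<beta> < lam"
    proof (rule ccontr)
      assume "\<nexists>\<beta>. \<beta> < lam"
      then have "\<kappa> \<le> \<xi>" for \<xi> using assms(5) by blast
      then have "{..<\<kappa>} = {}" by (auto dest: leD)
      moreover have "infinite {..<\<kappa>}"
        using assms(1) unfolding singular_cardinal_def infinite_cardinal_def by simp
      ultimately show False by simp
    qed
    fix \<beta> assume \<beta>: "\<beta> < lam"
    show "\<exists>\<gamma>. \<beta> < \<gamma> \<and> \<gamma> < lam"
    proof (rule ccontr)
      assume no: "\<nexists>\<gamma>. \<beta> < \<gamma> \<and> \<gamma> < lam"
      have "\<kappa>s \<alpha> \<le> \<kappa>s \<beta>" if "\<alpha> < lam" for \<alpha>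
        using no less[of \<alpha> \<beta>] that \<beta> by (metis less_imp_le linorder_neqE order_refl)
      then have "\<kappa> \<le> \<kappa>s \<beta>" using assms(5) by blast
      moreover have "\<kappa>s \<beta> \<le> \<kappa>" using assms(5) \<beta> by blast
      ultimately have "\<kappa>s \<beta> = \<kappa>" by simp
      then show False
        using reg[OF \<beta>] assms(1) unfolding regular_cardinal_def singular_cardinal_def by simp
    qed
  qed
  interpret node_tree lam \<kappa>s
  proof
    show "limit_ord lam" by (rule limit)
    show "\<kappa>s \<alpha> \<le> \<kappa>s \<beta>" if "\<alpha> \<le> \<beta>" "\<beta> < lam" for \<alpha> \<beta>
      using less[of \<alpha> \<beta>] that by (metis le_less order_refl)
    show "infinite {..<\<kappa>s \<alpha>}" if "\<alpha> < lam" for \<alpha> by (rule inf[OF that])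
  qed
  \<comment> \<open>From level \<open>\<gamma>\<close> on, the product trees used for nonemptiness
    satisfy their requirements; \<open>\<zeta>\<close> under it is the last exempt level of the
    stationary tree.\<close>
  obtain \<zeta> \<gamma> where \<zeta>\<gamma>: "\<zeta> < \<gamma>" "\<gamma> < lam" using limit unfolding limit_ord_def by blast
  have full: "{..<\<kappa>s \<xi>} \<noteq> {}" if "\<xi> < lam" for \<xi> using inf[OF that] by auto
  define Q_club where "Q_club \<xi> X \<longleftrightarrow> (\<exists>C. club_in (\<kappa>s \<xi>) C \<and> C \<subseteq> X)" for \<xi> X
  define \<Omega> where "\<Omega> \<xi> = {\<beta>. \<beta> < \<kappa>s \<xi> \<and> cofinality \<beta> = omega_ord}" for \<xi>
  define Q_stat where "Q_stat \<xi> X \<longleftrightarrow> X \<subseteq> \<Omega> \<xi> \<and> stationary_in (\<kappa>s \<xi>) X" for \<xi> X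
  have club: "M_club lam \<kappa>s = branching_trees lam \<kappa>s Q_club"
  proof -
    have "{..<\<kappa>s \<xi>} \<lesssim> X" if "\<xi> < lam" "Q_club \<xi> X" for \<xi> X
      using club_lepoll[OF reg[OF that(1)]] that(2) subset_imp_lepoll lepoll_trans
      unfolding Q_club_def by blast
    from perfect_trees_eq_branching_trees[of Q_club, OF this] show ?thesis
      unfolding M_club_def Q_club_def by simp
  qed
  have stat: "M_stat lam \<kappa>s = branching_trees lam \<kappa>s Q_stat"
  proof -
    have "{..<\<kappa>s \<xi>} \<lesssim> X" if "\<xi> < lam" "Q_stat \<xi> X" for \<xi> X
      using stationary_lepoll[OF reg[OF that(1)]] that(2) unfolding Q_stat_def by blast
    from perfect_trees_eq_branching_trees[of Q_stat, OF this] show ?thesis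
      unfolding M_stat_def Q_stat_def \<Omega>_def by simp
  qed
  have ne: "branching_trees lam \<kappa>s (\<lambda>_ _. True) \<noteq> {}"
    using product_tree_condition[of "\<lambda>\<xi>. {..<\<kappa>s \<xi>}" \<gamma> "\<lambda>_ _. True"] full \<zeta>\<gamma>(2) by auto
  have ne_club: "branching_trees lam \<kappa>s Q_club \<noteq> {}"
    using product_tree_condition[of "\<lambda>\<xi>. {..<\<kappa>s \<xi>}" \<gamma> Q_club] full \<zeta>\<gamma>(2) club_lessThan
    unfolding Q_club_def by auto
  have ne_stat: "branching_trees lam \<kappa>s Q_stat \<noteq> {}"
  proof -
    \<comment> \<open>Level \<open>\<zeta>\<close> and below are exempt because \<open>\<kappa>s \<zeta>\<close> may be \<open>\<omega>\<close>.\<close>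
    define S where "S \<xi> = (if \<zeta> < \<xi> then \<Omega> \<xi> else {..<\<kappa>s \<xi>})" for \<xi>
    have st: "stationary_in (\<kappa>s \<xi>) (\<Omega> \<xi>)" if "\<zeta> < \<xi>" "\<xi> < lam" for \<xi>
    proof -
      have "omega_ord \<le> \<kappa>s \<zeta>" using omega_ord_le inf that by (meson less_trans)
      then have "omega_ord < \<kappa>s \<xi>" using less[OF that] by (rule le_less_trans)
      then show ?thesis unfolding \<Omega>_def using stationary_cofinality_omega reg that(2) by blast
    qed
    have sub: "S \<xi> \<subseteq> {..<\<kappa>s \<xi>}" for \<xi> unfolding S_def \<Omega>_def by auto
    have ne: "S \<xi> \<noteq> {}" if "\<xi> < lam" for \<xi>
      using st[of \<xi>] full[OF that] that club_lessThan unfolding S_def stationary_in_def by auto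
    have "{..<\<kappa>s \<xi>} \<lesssim> S \<xi> \<and> Q_stat \<xi> (S \<xi>)" if "\<gamma> \<le> \<xi>" "\<xi> < lam" for \<xi>
    proof -
      have "\<zeta> < \<xi>" using \<zeta>\<gamma>(1) that(1) by simp
      then show ?thesis
        using st[of \<xi>] stationary_lepoll[OF reg[OF that(2)]] that(2) unfolding S_def Q_stat_def by simp
    qed
    from product_tree_condition[of S \<gamma> Q_stat, OF sub ne \<zeta>\<gamma>(2) this] show ?thesis by blast
  qed
  show ?thesis
    using branching_trees_forcing[OF ne] branching_trees_forcing[OF ne_club]
      branching_trees_forcing[OF ne_stat]
    unfolding M_forcing_eq club stat by blast
qed

end
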